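(* Let $G$ be a finite simple graph and $\mathcal{T}^\circ$ a maximal tubing on $G$. Then: (Span Property) For any proper tube $U$ of $G$, the linear span of $\{\mathbf{d}(\mathcal{T}^\circ,S): S\in\mathcal{T}, S\subseteq U\}$, for $\mathcal{T}$ a maximal tubing on $G$ containing $U$, does not depend on the choice of $\mathcal{T}$. (Flip Property) For any two maximal tubings $\mathcal{T},\mathcal{T}'$ with $\mathcal{T}\setminus\{T\}=\mathcal{T}'\setminus\{T'\}$ ($T\ne T'$), there is a linear dependence \[ \alpha\,\mathbf{d}(\mathcal{T}^\circ,T)+\alpha'\,\mathbf{d}(\mathcal{T}^\circ,T')+\sum_{S\in\mathcal{T}\cap\mathcal{T}'}\beta_S\,\mathbf{d}(\mathcal{T}^\circ,S)=0 \] in which $\alpha$ and $\alpha'$ are nonzero and have the same sign, and $\beta_S=0$ for every $S\not\subseteq T\cup T'$.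
   Context: For a finite simple graph $G$ with vertex set $V$ and $n=|V|-(\text{number of connected components})$: a tube is a nonempty subset of $V$ inducing a connected subgraph, proper if it is not a connected component. Two tubes are compatible if nested or disjoint and non-adjacent (their union is not a tube). A tubing is a set of pairwise compatible proper tubes; maximal tubings have $n$ tubes. The compatibility degree is $\delta(T\,\|\,T')=-1$ if $T=T'$; the number of vertices of $T'\setminus T$ adjacent to some vertex of $T$ if $T\not\subseteq T'$; $0$ otherwise. For $\mathcal{T}^\circ=\{T^\circ_1,\dots,T^\circ_n\}$, $\mathbf{d}(\mathcal{T}^\circ,T)=(\delta(T^\circ_1\,\|\,T),\dots,\delta(T^\circ_n\,\|\,T))\in\mathbb{R}^n$. *)

theory Defs
  imports
    Complex_Main
    "HOL-Library.Function_Algebras"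
    "Graph_Theory.Digraph_Component"
begin

text \<open>Functions into a real vector space, with pointwise operations (addition comes from
  \<^theory>\<open>HOL-Library.Function_Algebras\<close>), so that \<open>span\<close> and \<open>*\<^sub>R\<close> apply to them.\<close>

instantiation "fun" :: (type, real_vector) real_vector
begin

definition scaleR_fun :: "real \<Rightarrow> ('a \<Rightarrow> 'b) \<Rightarrow> 'a \<Rightarrow> 'b" where
  "scaleR_fun c f = (\<lambda>x. c *\<^sub>R f x)"

instance
  by standard (auto simp: scaleR_fun_def fun_eq_iff algebra_simps)

end

text \<open>Finite simple graphs are the locale \<open>graph\<close> of \<open>Graph_Theory\<close>: finite symmetric digraphs
  without loops and parallel arcs.  Several constants are written with their theory name because
  \<^theory>\<open>Complex_Main\<close> has other constants called \<open>graph\<close> and \<open>connected\<close>.\<close>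

text \<open>Graph connectedness in \<open>Graph_Theory\<close> includes nonemptiness of the vertex set.\<close>

definition tube :: "('a, 'b) pre_digraph \<Rightarrow> 'a set \<Rightarrow> bool" where
  "tube G T \<longleftrightarrow> T \<noteq> {} \<and> T \<subseteq> verts G \<and> Digraph_Component.connected (G \<restriction> T)"

text \<open>\<open>sccs_verts\<close> is the set of vertex sets of the strongly connected components; for a
  symmetric digraph these are the connected components of the graph.\<close>

definition proper_tube :: "('a, 'b) pre_digraph \<Rightarrow> 'a set \<Rightarrow> bool" where
  "proper_tube G T \<longleftrightarrow> tube G T \<and> T \<notin> pre_digraph.sccs_verts G"

definition compatible_tubes :: "('a, 'b) pre_digraph \<Rightarrow> 'a set \<Rightarrow> 'a set \<Rightarrow> bool" where
  "compatible_tubes G T T' \<longleftrightarrow>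
     T \<subseteq> T' \<or> T' \<subseteq> T \<or> (T \<inter> T' = {} \<and> \<not> tube G (T \<union> T'))"

definition tubing :: "('a, 'b) pre_digraph \<Rightarrow> 'a set set \<Rightarrow> bool" where
  "tubing G \<T> \<longleftrightarrow>
     (\<forall>T\<in>\<T>. proper_tube G T) \<and> (\<forall>T\<in>\<T>. \<forall>T'\<in>\<T>. compatible_tubes G T T')"

definition maximal_tubing :: "('a, 'b) pre_digraph \<Rightarrow> 'a set set \<Rightarrow> bool" where
  "maximal_tubing G \<T> \<longleftrightarrow>
     tubing G \<T> \<and> (\<forall>\<T>'. tubing G \<T>' \<and> \<T> \<subseteq> \<T>' \<longrightarrow> \<T>' = \<T>)"

definition compat_degree :: "('a, 'b) pre_digraph \<Rightarrow> 'a set \<Rightarrow> 'a set \<Rightarrow> int" where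
  "compat_degree G T T' =
     (if T = T' then - 1
      else if \<not> T \<subseteq> T' then int (card {v \<in> T' - T. \<exists>u\<in>T. u \<rightarrow>\<^bsub>G\<^esub> v})
      else 0)"

text \<open>The coordinates of $\mathbb{R}^n$ are indexed by the $n$ tubes of the initial maximal tubing
  \<open>\<T>\<^sub>0\<close> themselves: $\mathbb{R}^n$ is the space of real functions on tubes that vanish outside
  \<open>\<T>\<^sub>0\<close>.  No enumeration of \<open>\<T>\<^sub>0\<close> is needed, and $n = 0$ is covered.\<close>

definition compat_vector ::
    "('a, 'b) pre_digraph \<Rightarrow> 'a set set \<Rightarrow> 'a set \<Rightarrow> ('a set \<Rightarrow> real)" where
  "compat_vector G \<T>\<^sub>0 T =
     (\<lambda>S. if S \<in> \<T>\<^sub>0 then real_of_int (compat_degree G S T) else 0)"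

end

theory Submission
  imports Defs
begin

text \<open>
  Let \<open>e\<^sub>S\<close>, \<open>S \<in> \<T>\<^sub>0\<close>, be the standard basis, and for a vertex \<open>x\<close> let \<open>f\<^sub>x\<close> be the sum of the
  \<open>e\<^sub>S\<close> for which \<open>x\<close> is a neighbour of \<open>S\<close>.  Then \<open>d(T)\<close> is the sum of the \<open>f\<^sub>x\<close> with
  \<open>x \<in> T\<close>, minus positive multiples of the \<open>e\<^sub>S\<close> with \<open>S \<subseteq> T\<close>.  For a vertex set \<open>Y\<close> let \<open>M(Y)\<close> be
  spanned by the \<open>e\<^sub>S\<close> with \<open>S \<subseteq> Y\<close> and the \<open>f\<^sub>x\<close> with \<open>x \<in> Y\<close>.

  Span property: the span of the \<open>d(S)\<close>, \<open>S \<in> \<T>\<close>, \<open>S \<subseteq> U\<close>, is \<open>M(U)\<close>, which does not mention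
  \<open>\<T>\<close>.  Every tube of a maximal tubing has exactly one vertex, its root, in no smaller tube of the
  tubing.  Remove the root \<open>v\<close> of \<open>U\<close>: modulo \<open>M(U - v)\<close>, the tubes \<open>S\<close> of \<open>\<T>\<^sub>0\<close> with
  \<open>v \<in> S \<subseteq> U\<close> form a chain, and \<open>f\<^sub>r\<close> for the root \<open>r\<close> of the next tube of the chain shows that all
  \<open>e\<^sub>S\<close> except the topmost vanish.  So \<open>M(U)\<close> is at most one-dimensional modulo \<open>M(U - v)\<close>, and
  \<open>d(U)\<close> generates it, being \<open>f\<^sub>v\<close> or a negative multiple of the topmost \<open>e\<^sub>S\<close>.

  Flip property: let \<open>v\<close>, \<open>w\<close> be the roots of \<open>T\<close>, \<open>T'\<close> and work modulo \<open>M(X - {v, w})\<close> for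
  \<open>X = T \<union> T'\<close>.  As before \<open>d(T)\<close> is \<open>f\<^sub>v\<close> or a negative multiple of a topmost \<open>e\<^sub>S\<close> with
  \<open>v \<in> S \<subseteq> T\<close>, and \<open>d(T')\<close> is \<open>f\<^sub>w\<close> or a negative multiple of some \<open>e\<^sub>R\<close>.  If \<open>Q\<close> is a smallest
  tube of \<open>\<T>\<^sub>0\<close> inside \<open>X\<close> containing \<open>v\<close> and \<open>w\<close>, its root \<open>r\<close> gives the relation:
  \<open>f\<^sub>w = e\<^sub>S\<close> if \<open>r = w\<close>, and \<open>e\<^sub>S + e\<^sub>R = f\<^sub>r = 0\<close> if \<open>r\<close> is neither \<open>v\<close> nor \<open>w\<close>.  If there is no
  such \<open>Q\<close>, then \<open>d(X)\<close> is the sum of a positive multiple of \<open>d(T)\<close> and one of \<open>d(T')\<close>.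
\<close>

section \<open>Tubes and tubings\<close>

context graph
begin

section \<open>Connectivity of tubes through edge cuts\<close>

text \<open>Replaces walks by single edges across a cut. For the converse, the vertices reachable
  from \<open>u\<close> inside \<open>T\<close> would form a cut that no edge leaves.\<close>

lemma tube_iff_cut:
  "tube G T \<longleftrightarrow> T \<noteq> {} \<and> T \<subseteq> verts G \<and>
     (\<forall>A. A \<noteq> {} \<and> A \<subset> T \<longrightarrow> (\<exists>a\<in>A. \<exists>b\<in>T - A. a \<rightarrow>\<^bsub>G\<^esub> b))"
proof -
  have ends: "(arcs_ends (G \<restriction> T))\<^sup>s = {(a, b). a \<rightarrow>\<^bsub>G\<^esub> b \<and> a \<in> T \<and> b \<in> T}" if "T \<subseteq> verts G"
    by (auto simp: symcl_def arcs_ends_conv dest: arcs_ends_symmetric)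
       (use graph_symmetric in \<open>auto simp: arcs_ends_conv\<close>)
  show ?thesis
  proof (intro iffI conjI allI impI; (elim conjE)?)
    fix A assume "tube G T" "A \<noteq> {}" "A \<subset> T"
    then have conn: "Digraph_Component.connected (G \<restriction> T)" and sub: "T \<subseteq> verts G"
      by (auto simp: tube_def)
    from \<open>A \<noteq> {}\<close> \<open>A \<subset> T\<close> obtain u v where uv: "u \<in> A" "v \<in> T - A" by blast
    then have "(u, v) \<in> rtrancl_on T {(a, b). a \<rightarrow>\<^bsub>G\<^esub> b \<and> a \<in> T \<and> b \<in> T}"
      using conn \<open>A \<subset> T\<close> unfolding connected_conv ends[OF sub] by auto
    then have "v \<in> A \<or> (\<exists>a\<in>A. \<exists>b\<in>T - A. a \<rightarrow>\<^bsub>G\<^esub> b)"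
      by (induction rule: rtrancl_on_induct) (use uv in auto)
    with uv show "\<exists>a\<in>A. \<exists>b\<in>T - A. a \<rightarrow>\<^bsub>G\<^esub> b" by blast
  next
    assume ne: "T \<noteq> {}" and sub: "T \<subseteq> verts G"
      and cut: "\<forall>A. A \<noteq> {} \<and> A \<subset> T \<longrightarrow> (\<exists>a\<in>A. \<exists>b\<in>T - A. a \<rightarrow>\<^bsub>G\<^esub> b)"
    let ?R = "{(a, b). a \<rightarrow>\<^bsub>G\<^esub> b \<and> a \<in> T \<and> b \<in> T}"
    have "(u, v) \<in> rtrancl_on T ?R" if "u \<in> T" "v \<in> T" for u v
    proof (rule ccontr)
      assume nr: "(u, v) \<notin> rtrancl_on T ?R"
      define A where "A = {x \<in> T. (u, x) \<in> rtrancl_on T ?R}"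
      have "u \<in> A" using that by (simp add: A_def)
      moreover have "v \<notin> A" using nr by (simp add: A_def)
      moreover have "A \<subseteq> T" by (auto simp: A_def)
      ultimately have "A \<noteq> {} \<and> A \<subset> T" using that by blast
      then obtain a b where ab: "a \<in> A" "b \<in> T - A" "a \<rightarrow>\<^bsub>G\<^esub> b"
        using cut by meson
      then have "(u, a) \<in> rtrancl_on T ?R" "(a, b) \<in> ?R" "b \<in> T" by (auto simp: A_def)
      then have "(u, b) \<in> rtrancl_on T ?R" by (rule rtrancl_on_into_rtrancl_on)
      then show False using ab by (simp add: A_def)
    qed
    then show "tube G T" using ne sub by (simp add: tube_def connected_conv ends)
  qed (auto simp: tube_def)
qed

lemma tube_verts: "tube G T \<Longrightarrow> T \<subseteq> verts G"
  and tube_nonempty: "tube G T \<Longrightarrow> T \<noteq> {}"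
  by (auto simp: tube_def)

lemma tube_finite: "tube G T \<Longrightarrow> finite T"
  using tube_verts finite_subset finite_verts by blast

lemma tube_edgeE:
  assumes "tube G T" "a \<in> T \<inter> A" "b \<in> T - A"
  obtains x y where "x \<in> T \<inter> A" "y \<in> T - A" "x \<rightarrow>\<^bsub>G\<^esub> y"
  using assms unfolding tube_iff_cut
  by (metis Diff_Int_distrib Diff_iff Int_iff Int_lower1 empty_iff psubsetI)

lemma tube_singleton: "x \<in> verts G \<Longrightarrow> tube G {x}"
  unfolding tube_iff_cut by (auto simp: psubset_eq subset_singleton_iff)

text \<open>If no edge left \<open>A\<close> inside \<open>S \<union> T\<close>, each of the two
  tubes would lie wholly inside or wholly outside \<open>A\<close>. So \<open>A\<close> would
  separate \<open>S\<close> from \<open>T\<close>, against \<open>meet\<close>.\<close>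

lemma tube_Un:
  assumes S: "tube G S" and T: "tube G T" and meet: "S \<inter> T \<noteq> {} \<or> (\<exists>a\<in>S. \<exists>b\<in>T. a \<rightarrow>\<^bsub>G\<^esub> b)"
  shows "tube G (S \<union> T)"
  unfolding tube_iff_cut
proof (intro conjI allI impI)
  fix A assume A: "A \<noteq> {} \<and> A \<subset> S \<union> T"
  show "\<exists>a\<in>A. \<exists>b\<in>S \<union> T - A. a \<rightarrow>\<^bsub>G\<^esub> b"
  proof (rule ccontr)
    assume no: "\<not> ?thesis"
    have all: "U \<inter> A = {} \<or> U \<subseteq> A" if U: "tube G U" "U \<subseteq> S \<union> T" for U
    proof (rule ccontr)
      assume "\<not> ?thesis"
      then obtain a b where "a \<in> U \<inter> A" "b \<in> U - A" by blast
      then obtain x y where "x \<in> U \<inter> A" "y \<in> U - A" "x \<rightarrow>\<^bsub>G\<^esub> y" by (rule tube_edgeE[OF U(1)])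
      then show False using no U(2) by blast
    qed
    have "S \<inter> A = {} \<or> S \<subseteq> A" "T \<inter> A = {} \<or> T \<subseteq> A" using all S T by auto
    with A have A': "S \<inter> A = {} \<and> T \<subseteq> A \<or> S \<subseteq> A \<and> T \<inter> A = {}" by blast
    with meet obtain a b where "a \<in> S" "b \<in> T" "a \<rightarrow>\<^bsub>G\<^esub> b" by blast
    moreover from this have "b \<rightarrow>\<^bsub>G\<^esub> a" by (simp add: graph_symmetric)
    ultimately show False using A' no by blast
  qed
qed (use S T tube_verts tube_nonempty in auto)

lemma compatible_tubes_iff:
  assumes "tube G S" "tube G T"
  shows "compatible_tubes G S T \<longleftrightarrow>
    S \<subseteq> T \<or> T \<subseteq> S \<or> (S \<inter> T = {} \<and> \<not> (\<exists>a\<in>S. \<exists>b\<in>T. a \<rightarrow>\<^bsub>G\<^esub> b))"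
proof -
  have "tube G (S \<union> T) \<longleftrightarrow> (\<exists>a\<in>S. \<exists>b\<in>T. a \<rightarrow>\<^bsub>G\<^esub> b)" if "S \<inter> T = {}"
  proof
    assume "tube G (S \<union> T)"
    moreover obtain a b where "a \<in> S" "b \<in> T" using assms[THEN tube_nonempty] by blast
    then have "a \<in> (S \<union> T) \<inter> S" "b \<in> S \<union> T - S" using that by auto
    ultimately obtain x y where "x \<in> (S \<union> T) \<inter> S" "y \<in> S \<union> T - S" "x \<rightarrow>\<^bsub>G\<^esub> y"
      by (rule tube_edgeE)
    then show "\<exists>a\<in>S. \<exists>b\<in>T. a \<rightarrow>\<^bsub>G\<^esub> b" by blast
  qed (use assms tube_Un in blast)
  then show ?thesis unfolding compatible_tubes_def by blast
qed

text \<open>A tube that no edge leaves is closed under reachability, hence a whole component;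
  conversely no edge leaves a component.\<close>

lemma proper_tube_iff: "proper_tube G T \<longleftrightarrow> tube G T \<and> (\<exists>a\<in>T. \<exists>b. b \<notin> T \<and> a \<rightarrow>\<^bsub>G\<^esub> b)"
proof (cases "tube G T")
  case True
  have "T \<in> sccs_verts \<longleftrightarrow> \<not> (\<exists>a\<in>T. \<exists>b. b \<notin> T \<and> a \<rightarrow>\<^bsub>G\<^esub> b)"
  proof
    assume "T \<in> sccs_verts"
    then show "\<not> (\<exists>a\<in>T. \<exists>b. b \<notin> T \<and> a \<rightarrow>\<^bsub>G\<^esub> b)"
      unfolding sccs_verts_def using graph_symmetric reachable_adjI by blast
  next
    assume closed: "\<not> (\<exists>a\<in>T. \<exists>b. b \<notin> T \<and> a \<rightarrow>\<^bsub>G\<^esub> b)"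
    have stay: "v \<in> T" if "u \<rightarrow>\<^sup>* v" "u \<in> T" for u v
      using that by (induction rule: reachable_induct) (use closed in auto)
    have "u \<rightarrow>\<^sup>* v" if "u \<in> T" "v \<in> T" for u v
    proof (rule ccontr)
      assume "\<not> u \<rightarrow>\<^sup>* v"
      moreover have "u \<rightarrow>\<^sup>* u" using that tube_verts[OF True] by blast
      ultimately have "u \<in> T \<inter> {x. u \<rightarrow>\<^sup>* x}" "v \<in> T - {x. u \<rightarrow>\<^sup>* x}" using that by auto
      then obtain x y where "x \<in> T \<inter> {x. u \<rightarrow>\<^sup>* x}" "y \<in> T - {x. u \<rightarrow>\<^sup>* x}" "x \<rightarrow>\<^bsub>G\<^esub> y"
        by (rule tube_edgeE[OF True])
      then show False using reachable_adj_trans by blast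
    qed
    then show "T \<in> sccs_verts" using True stay
      unfolding sccs_verts_def tube_def by blast
  qed
  with True show ?thesis by (simp add: proper_tube_def)
qed (simp add: proper_tube_def)

lemma tube_subset_proper:
  assumes "tube G S" "tube G T" "S \<subset> T"
  shows "proper_tube G S"
proof -
  obtain a b where "a \<in> T \<inter> S" "b \<in> T - S" using assms tube_nonempty by blast
  then show ?thesis using tube_edgeE[OF assms(2)] assms(1) unfolding proper_tube_iff by (metis DiffD2 Int_iff)
qed

text \<open>\<open>C\<close> is an inclusion-maximal tube in \<open>Y\<close> through
  \<open>x\<close>; by \<open>tube_Un\<close>, any tube in \<open>Y\<close> that meets or touches it
  can be merged into it.\<close>

lemma component_exists:
  assumes "x \<in> Y" "Y \<subseteq> verts G"
  obtains C where "tube G C" "x \<in> C" "C \<subseteq> Y"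
    "\<And>D. tube G D \<Longrightarrow> D \<subseteq> Y \<Longrightarrow> D \<inter> C \<noteq> {} \<or> (\<exists>a\<in>D. \<exists>b\<in>C. a \<rightarrow>\<^bsub>G\<^esub> b) \<Longrightarrow> D \<subseteq> C"
proof -
  let ?F = "{C. tube G C \<and> x \<in> C \<and> C \<subseteq> Y}"
  have "finite ?F" using finite_subset[OF assms(2)] by (auto intro: finite_subset[of _ "Pow Y"])
  moreover have "{x} \<in> ?F" using assms tube_singleton by auto
  ultimately obtain C where C: "C \<in> ?F" and max: "\<forall>D\<in>?F. C \<subseteq> D \<longrightarrow> C = D"
    using finite_has_maximal[of ?F] by blast
  have "D \<subseteq> C" if "tube G D" "D \<subseteq> Y" "D \<inter> C \<noteq> {} \<or> (\<exists>a\<in>D. \<exists>b\<in>C. a \<rightarrow>\<^bsub>G\<^esub> b)" for D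
  proof -
    have "tube G (D \<union> C)" using tube_Un that C by blast
    then have "C = D \<union> C" using max C that by blast
    then show ?thesis by blast
  qed
  with C that show ?thesis by blast
qed

section \<open>Roots of tubes in maximal tubings\<close>

lemma compatible_tubes_sym: "compatible_tubes G S T \<longleftrightarrow> compatible_tubes G T S"
  unfolding compatible_tubes_def by (auto simp: Un_commute)

lemma tubing_tube: "tubing G \<T> \<Longrightarrow> S \<in> \<T> \<Longrightarrow> tube G S"
  by (auto simp: tubing_def proper_tube_def)

lemma tubing_finite: "tubing G \<T> \<Longrightarrow> finite \<T>"
  using tubing_tube tube_verts finite_verts
  by (meson PowI finite_Pow_iff finite_subset subsetI)

lemma tubing_cases [consumes 3, case_names sub sup apart]:
  assumes "tubing G \<T>" "S \<in> \<T>" "T \<in> \<T>"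
  obtains "S \<subseteq> T" | "T \<subseteq> S" | "S \<inter> T = {}" "\<not> (\<exists>a\<in>S. \<exists>b\<in>T. a \<rightarrow>\<^bsub>G\<^esub> b)"
proof -
  have "compatible_tubes G S T" using assms unfolding tubing_def by blast
  then show ?thesis using compatible_tubes_iff tubing_tube assms that by metis
qed

lemma maximal_tubing_insert:
  assumes "maximal_tubing G \<T>" "proper_tube G C" "\<And>S. S \<in> \<T> \<Longrightarrow> compatible_tubes G S C"
  shows "C \<in> \<T>"
proof -
  have "tubing G (insert C \<T>)"
    using assms compatible_tubes_sym unfolding maximal_tubing_def tubing_def
    by (auto simp: compatible_tubes_def)
  then show ?thesis using assms(1) unfolding maximal_tubing_def by blast
qed

text \<open>If the smaller tubes covered \<open>U\<close>, an edge of \<open>U\<close> leaving a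
  maximal one would end in another one incompatible with it. Given an uncovered \<open>x\<close>,
  maximality forces the components of \<open>U - {x}\<close> into \<open>\<T>\<close>, so every
  other vertex is covered.\<close>

lemma maximal_tubing_root:
  assumes max: "maximal_tubing G \<T>" and U: "U \<in> \<T>"
  obtains v where "v \<in> U" "\<Union>{S \<in> \<T>. S \<subset> U} = U - {v}"
proof -
  have tub: "tubing G \<T>" using max maximal_tubing_def by blast
  note tube = tubing_tube[OF tub]
  let ?F = "{S \<in> \<T>. S \<subset> U}"
  have "\<Union>?F \<noteq> U"
  proof
    assume eq: "\<Union>?F = U"
    have "?F \<noteq> {}"
    proof
      assume "?F = {}"
      then have "U = {}" using eq by (metis Union_empty)
      then show False using tube_nonempty[OF tube[OF U]] by contradiction
    qed
    moreover have "finite ?F" using tubing_finite[OF tub] by simp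
    ultimately obtain S where S: "S \<in> ?F" and Smax: "\<forall>D\<in>?F. S \<subseteq> D \<longrightarrow> S = D"
      using finite_has_maximal by (metis (no_types, lifting))
    have ST: "S \<in> \<T>" and SU: "S \<subset> U" using S by auto
    obtain a b where "a \<in> U \<inter> S" "b \<in> U - S" using SU tube_nonempty[OF tube[OF ST]] by blast
    then obtain x y where xy: "x \<in> U \<inter> S" "y \<in> U - S" "x \<rightarrow>\<^bsub>G\<^esub> y"
      by (rule tube_edgeE[OF tube[OF U]])
    then obtain R where R: "R \<in> ?F" "y \<in> R" using eq by blast
    then have "R \<in> \<T>" by blast
    with tub ST show False
    proof (cases rule: tubing_cases)
      case sub
      then have "S = R" using Smax R by blast
      then show False using R xy by blast
    qed (use R xy in auto)
  qed
  moreover have "\<Union>?F \<subseteq> U" by blast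
  ultimately obtain x where x: "x \<in> U" "x \<notin> \<Union>?F" by blast
  have "y \<in> \<Union>?F" if y: "y \<in> U - {x}" for y
  proof -
    have UV: "U - {x} \<subseteq> verts G" using tube_verts[OF tube[OF U]] by blast
    obtain C where C: "tube G C" "y \<in> C" "C \<subseteq> U - {x}" and Cmax:
      "\<And>D. tube G D \<Longrightarrow> D \<subseteq> U - {x} \<Longrightarrow> D \<inter> C \<noteq> {} \<or> (\<exists>a\<in>D. \<exists>b\<in>C. a \<rightarrow>\<^bsub>G\<^esub> b) \<Longrightarrow> D \<subseteq> C"
      using component_exists[OF y UV] by metis
    have CU: "C \<subset> U" using C x by blast
    have "compatible_tubes G S C" if S: "S \<in> \<T>" for S
      using tub S U
    proof (cases rule: tubing_cases)
      case sub
      show ?thesis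
      proof (cases "S = U")
        case False
        then have "S \<subseteq> \<Union>?F" using S sub by blast
        then have "S \<subseteq> U - {x}" using x(2) sub by blast
        then show ?thesis unfolding compatible_tubes_iff[OF tube[OF S] C(1)]
          using Cmax[OF tube[OF S]] by meson
      next
        case True
        then show ?thesis using CU unfolding compatible_tubes_def by blast
      qed
    next
      case sup
      then have "C \<subseteq> S" using CU by simp
      then show ?thesis unfolding compatible_tubes_def by simp
    next
      case apart
      then have "S \<inter> C = {} \<and> \<not> (\<exists>a\<in>S. \<exists>b\<in>C. a \<rightarrow>\<^bsub>G\<^esub> b)"
        using CU by (auto dest: psubsetD)
      then show ?thesis unfolding compatible_tubes_iff[OF tube[OF S] C(1)] by simp
    qed
    note comp = this
    have "C \<in> \<T>"
      by (rule maximal_tubing_insert[OF max tube_subset_proper[OF C(1) tube[OF U] CU] comp])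
    then show ?thesis using CU C by blast
  qed
  then have "\<Union>?F = U - {x}" using x by blast
  with x that show ?thesis by blast
qed

text \<open>The configuration of a flip: \<open>v\<close> is the vertex of \<open>T\<close> in no smaller tube of its tubing, \<open>w\<close>
  likewise for \<open>T'\<close>, and \<open>T\<close>, \<open>T'\<close> are the components of \<open>v\<close>, \<open>w\<close> in \<open>T \<union> T'\<close> without \<open>w\<close>,
  respectively without \<open>v\<close>.\<close>

definition flip_pair :: "'a \<Rightarrow> 'a \<Rightarrow> 'a set \<Rightarrow> 'a set \<Rightarrow> bool" where
  "flip_pair v w T T' \<longleftrightarrow> tube G T \<and> tube G T' \<and> tube G (T \<union> T') \<and>
     v \<in> T \<and> v \<notin> T' \<and> w \<in> T' \<and> w \<notin> T \<and>
     (\<forall>D. tube G D \<and> D \<subseteq> T \<union> T' \<and> v \<in> D \<and> w \<notin> D \<longrightarrow> D \<subseteq> T) \<and>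
     (\<forall>D. tube G D \<and> D \<subseteq> T \<union> T' \<and> w \<in> D \<and> v \<notin> D \<longrightarrow> D \<subseteq> T')"

lemma flip_pair_sym: "flip_pair v w T T' \<Longrightarrow> flip_pair w v T' T"
  unfolding flip_pair_def by (simp add: Un_commute)

lemma flip_pairD:
  assumes "flip_pair v w T T'"
  shows "tube G T" "tube G T'" "tube G (T \<union> T')" "v \<in> T" "v \<notin> T'" "w \<in> T'" "w \<notin> T"
    and "\<And>D. tube G D \<Longrightarrow> D \<subseteq> T \<union> T' \<Longrightarrow> v \<in> D \<Longrightarrow> w \<notin> D \<Longrightarrow> D \<subseteq> T"
    and "T - {v} \<subseteq> T \<union> T' - {v, w}" "T' - {w} \<subseteq> T \<union> T' - {v, w}"
  using assms unfolding flip_pair_def by auto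

text \<open>Otherwise \<open>T'\<close> would be compatible with all of \<open>\<T>\<close> and, by
  maximality, lie in \<open>\<T> - {T}\<close>, which is \<open>\<T>' - {T'}\<close>.\<close>

lemma flip_not_compatible:
  assumes "maximal_tubing G \<T>" "maximal_tubing G \<T>'" "T \<in> \<T>" "T' \<in> \<T>'" "T \<noteq> T'" "\<T> - {T} = \<T>' - {T'}"
  shows "\<not> compatible_tubes G T T'"
proof
  assume comp: "compatible_tubes G T T'"
  have tub': "tubing G \<T>'" using assms(2) by (simp add: maximal_tubing_def)
  have "T' \<in> \<T>"
  proof (rule maximal_tubing_insert[OF assms(1)])
    show "proper_tube G T'" using tub' assms(4) by (simp add: tubing_def)
    fix S assume S: "S \<in> \<T>"
    show "compatible_tubes G S T'"
    proof (cases "S = T")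
      case False
      then have "S \<in> \<T>'" using S assms(6) by blast
      then show ?thesis using tub' assms(4) by (simp add: tubing_def)
    qed (simp add: comp)
  qed
  then show False using assms(5,6) by blast
qed

text \<open>\<open>v\<close> and \<open>w\<close> are the roots of \<open>T\<close> and
  \<open>T'\<close>. The tubes of the two tubings strictly below \<open>T\<close> or
  \<open>T'\<close> are common to both; the covering by common tubes later turns membership in
  \<open>M\<close> into a combination of their vectors.\<close>

lemma flip_pair_exists:
  assumes max: "maximal_tubing G \<T>" "maximal_tubing G \<T>'" and TT: "T \<in> \<T>" "T' \<in> \<T>'"
    and ne: "T \<noteq> T'" and eq: "\<T> - {T} = \<T>' - {T'}"
  obtains v w where "flip_pair v w T T'"
    "T \<union> T' - {v, w} = \<Union>{S \<in> \<T> \<inter> \<T>'. S \<subseteq> T \<union> T' - {v, w}}"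
proof -
  have tub: "tubing G \<T>" "tubing G \<T>'" using max by (auto simp: maximal_tubing_def)
  have tube: "tube G T" "tube G T'" using tub TT tubing_tube by blast+
  note inc = flip_not_compatible[OF max TT ne eq]
  then have nsub: "\<not> T \<subseteq> T'" "\<not> T' \<subseteq> T" by (auto simp: compatible_tubes_def)
  have tubeX: "tube G (T \<union> T')"
    using inc tube_Un[OF tube] unfolding compatible_tubes_iff[OF tube] by blast
  have TnT: "T \<notin> \<T>'" "T' \<notin> \<T>" using eq ne TT by blast+
  obtain v where v: "v \<in> T" "\<Union>{S \<in> \<T>. S \<subset> T} = T - {v}" by (rule maximal_tubing_root[OF max(1) TT(1)])
  obtain w where w: "w \<in> T'" "\<Union>{S \<in> \<T>'. S \<subset> T'} = T' - {w}" by (rule maximal_tubing_root[OF max(2) TT(2)])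
  have below: "\<exists>S. S \<in> \<T> \<inter> \<T>' \<and> S \<subset> T \<and> x \<in> S" if x: "x \<in> T" "x \<noteq> v" for x
  proof -
    have "x \<in> \<Union>{S \<in> \<T>. S \<subset> T}" using v(2) x by simp
    then obtain S where "S \<in> \<T>" "S \<subset> T" "x \<in> S" by blast
    moreover from this have "S \<in> \<T>'" using eq by blast
    ultimately show ?thesis by blast
  qed
  have below': "\<exists>S. S \<in> \<T> \<inter> \<T>' \<and> S \<subset> T' \<and> x \<in> S" if x: "x \<in> T'" "x \<noteq> w" for x
  proof -
    have "x \<in> \<Union>{S \<in> \<T>'. S \<subset> T'}" using w(2) x by simp
    then obtain S where "S \<in> \<T>'" "S \<subset> T'" "x \<in> S" by blast
    moreover from this have "S \<in> \<T>" using eq by blast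
    ultimately show ?thesis by blast
  qed
  have apart: "S \<subseteq> T' \<or> S \<inter> T' = {} \<and> \<not> (\<exists>a\<in>S. \<exists>b\<in>T'. a \<rightarrow>\<^bsub>G\<^esub> b)"
    if S: "S \<in> \<T> \<inter> \<T>'" "S \<subset> T" for S
  proof -
    have "S \<in> \<T>'" using S by blast
    from tub(2) this TT(2) show ?thesis by (cases rule: tubing_cases) (use S nsub in auto)
  qed
  have apart': "S \<subseteq> T \<or> S \<inter> T = {} \<and> \<not> (\<exists>a\<in>S. \<exists>b\<in>T. a \<rightarrow>\<^bsub>G\<^esub> b)"
    if S: "S \<in> \<T> \<inter> \<T>'" "S \<subset> T'" for S
  proof -
    have "S \<in> \<T>" using S by blast
    from tub(1) this TT(1) show ?thesis by (cases rule: tubing_cases) (use S nsub in auto)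
  qed
  \<comment> \<open>Any vertex of \<open>T'\<close> other than \<open>w\<close> lies in a common
    tube below \<open>T'\<close>. If that vertex is outside \<open>T\<close>, compatibility with
    \<open>T\<close> forbids an edge to it from \<open>T\<close>.\<close>
  have cross: "y = w" if xy: "x \<in> T" "y \<in> T' - T" "x \<rightarrow>\<^bsub>G\<^esub> y" for x y
  proof (rule ccontr)
    assume "y \<noteq> w"
    then obtain S where S: "S \<in> \<T> \<inter> \<T>'" "S \<subset> T'" "y \<in> S" using below'[of y] xy by blast
    have "y \<rightarrow>\<^bsub>G\<^esub> x" using xy by (simp add: graph_symmetric)
    then show False using apart'[OF S(1,2)] S(3) xy by blast
  qed
  have cross': "y = v" if xy: "x \<in> T'" "y \<in> T - T'" "x \<rightarrow>\<^bsub>G\<^esub> y" for x y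
  proof (rule ccontr)
    assume "y \<noteq> v"
    then obtain S where S: "S \<in> \<T> \<inter> \<T>'" "S \<subset> T" "y \<in> S" using below[of y] xy by blast
    have "y \<rightarrow>\<^bsub>G\<^esub> x" using xy by (simp add: graph_symmetric)
    then show False using apart[OF S(1,2)] S(3) xy by blast
  qed
  \<comment> \<open>If \<open>w\<close> were in \<open>T\<close>, an edge of \<open>T'\<close> from
    \<open>T\<close> to \<open>T' - T\<close> would have to end at \<open>w\<close> by
    \<open>cross\<close>.\<close>
  have wT: "w \<notin> T"
  proof
    assume "w \<in> T"
    moreover obtain b where "b \<in> T' - T" using nsub by blast
    ultimately have "w \<in> T' \<inter> T" "b \<in> T' - T" using w by auto
    then obtain x y where "x \<in> T' \<inter> T" "y \<in> T' - T" "x \<rightarrow>\<^bsub>G\<^esub> y" by (rule tube_edgeE[OF tube(2)])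
    then show False using cross[of x y] \<open>w \<in> T\<close> by blast
  qed
  have vT': "v \<notin> T'"
  proof
    assume vT': "v \<in> T'"
    obtain b where "b \<in> T - T'" using nsub by blast
    then have "v \<in> T \<inter> T'" "b \<in> T - T'" using v vT' by auto
    then obtain x y where "x \<in> T \<inter> T'" "y \<in> T - T'" "x \<rightarrow>\<^bsub>G\<^esub> y" by (rule tube_edgeE[OF tube(1)])
    then show False using cross'[of x y] vT' by blast
  qed
  have "D \<subseteq> T" if D: "tube G D" "D \<subseteq> T \<union> T'" "v \<in> D" "w \<notin> D" for D
  proof (rule ccontr)
    assume "\<not> D \<subseteq> T"
    then obtain b where "v \<in> D \<inter> T" "b \<in> D - T" using D(3) v(1) by blast
    then obtain x y where "x \<in> D \<inter> T" "y \<in> D - T" "x \<rightarrow>\<^bsub>G\<^esub> y" by (rule tube_edgeE[OF D(1)])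
    then show False using cross[of x y] D by blast
  qed
  moreover have "D \<subseteq> T'" if D: "tube G D" "D \<subseteq> T \<union> T'" "w \<in> D" "v \<notin> D" for D
  proof (rule ccontr)
    assume "\<not> D \<subseteq> T'"
    then obtain b where "w \<in> D \<inter> T'" "b \<in> D - T'" using D(3) w(1) by blast
    then obtain x y where "x \<in> D \<inter> T'" "y \<in> D - T'" "x \<rightarrow>\<^bsub>G\<^esub> y" by (rule tube_edgeE[OF D(1)])
    then show False using cross'[of x y] D by blast
  qed
  ultimately have "flip_pair v w T T'"
    unfolding flip_pair_def using tube tubeX v(1) w(1) wT vT' by blast
  moreover have "T \<union> T' - {v, w} \<subseteq> \<Union>{S \<in> \<T> \<inter> \<T>'. S \<subseteq> T \<union> T' - {v, w}}"
  proof
    fix x assume x: "x \<in> T \<union> T' - {v, w}"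
    show "x \<in> \<Union>{S \<in> \<T> \<inter> \<T>'. S \<subseteq> T \<union> T' - {v, w}}"
    proof (cases "x \<in> T")
      case True
      then obtain S where S: "S \<in> \<T> \<inter> \<T>'" "S \<subset> T" "x \<in> S" using below x by blast
      then have "v \<notin> S" using v(2) by blast
      then have "S \<subseteq> T \<union> T' - {v, w}" using S(2) wT by blast
      then show ?thesis using S by blast
    next
      case False
      then obtain S where S: "S \<in> \<T> \<inter> \<T>'" "S \<subset> T'" "x \<in> S" using below' x by blast
      then have "w \<notin> S" using w(2) by blast
      then have "S \<subseteq> T \<union> T' - {v, w}" using S(2) vT' by blast
      then show ?thesis using S by blast
    qed
  qed
  ultimately show ?thesis using that by blast
qed

text \<open>A tube of \<open>\<T>\<close> other than \<open>T\<close> is common, hence compatible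
  with both \<open>T\<close> and \<open>T'\<close>. It cannot contain one and be apart from the
  other, because \<open>T\<close> and \<open>T'\<close> meet or are joined by an edge.\<close>

lemma flip_union_in:
  assumes max: "maximal_tubing G \<T>" "maximal_tubing G \<T>'" and TT: "T \<in> \<T>" "T' \<in> \<T>'"
    and ne: "T \<noteq> T'" and eq: "\<T> - {T} = \<T>' - {T'}" and proper: "proper_tube G (T \<union> T')"
  shows "T \<union> T' \<in> \<T> \<inter> \<T>'"
proof -
  have tub: "tubing G \<T>" "tubing G \<T>'" using max by (auto simp: maximal_tubing_def)
  have tube: "tube G T" "tube G T'" using tub TT tubing_tube by blast+
  note inc = flip_not_compatible[OF max TT ne eq]
  then have nsub: "\<not> T \<subseteq> T'" "\<not> T' \<subseteq> T" by (auto simp: compatible_tubes_def)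
  have meet: "T \<inter> T' \<noteq> {} \<or> (\<exists>a\<in>T. \<exists>b\<in>T'. a \<rightarrow>\<^bsub>G\<^esub> b)"
    using inc unfolding compatible_tubes_iff[OF tube] by blast
  have tubeX: "tube G (T \<union> T')" using proper by (simp add: proper_tube_def)
  have "compatible_tubes G S (T \<union> T')" if S: "S \<in> \<T>" for S
  proof (cases "S = T")
    case False
    then have S': "S \<in> \<T>'" using S eq by blast
    note comp_iff = compatible_tubes_iff[OF tubing_tube[OF tub(1) S] tubeX]
    from tub(1) S TT(1) show ?thesis
    proof (cases rule: tubing_cases)
      case sub
      then show ?thesis by (auto simp: compatible_tubes_def)
    next
      case sup
      from tub(2) S' TT(2) show ?thesis
      proof (cases rule: tubing_cases)
        case sub
        then show ?thesis using sup nsub by blast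
      next
        case sup
        with \<open>T \<subseteq> S\<close> show ?thesis by (auto simp: compatible_tubes_def)
      next
        case apart
        with sup meet show ?thesis by blast
      qed
    next
      case ST: apart
      from tub(2) S' TT(2) show ?thesis
      proof (cases rule: tubing_cases)
        case sub
        then show ?thesis by (auto simp: compatible_tubes_def)
      next
        case sup
        have "\<not> (\<exists>a\<in>T. \<exists>b\<in>S. a \<rightarrow>\<^bsub>G\<^esub> b)" using ST(2) graph_symmetric by meson
        with sup meet ST(1) show ?thesis by blast
      next
        case apart
        with ST show ?thesis unfolding comp_iff by blast
      qed
    qed
  qed (simp add: compatible_tubes_def)
  then have "T \<union> T' \<in> \<T>" by (rule maximal_tubing_insert[OF max(1) proper])
  moreover have "T \<union> T' \<noteq> T" using nsub by blast
  ultimately show ?thesis using eq by blast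
qed

end

section \<open>The spaces spanned by compatibility vectors\<close>

lemma sum_fun_apply: "(\<Sum>x\<in>A. g x) y = (\<Sum>x\<in>A. g x y)"
  for g :: "'a \<Rightarrow> 'b \<Rightarrow> 'c::comm_monoid_add"
  by (induction A rule: infinite_finite_induct) auto

text \<open>The coefficients are indexed by \<open>A\<close> and not by the image, so
  \<open>g\<close> may fail to be injective; this suits a dependence indexed by tubes.\<close>

lemma span_image_finite:
  assumes "finite A" "x \<in> span (g ` A)"
  obtains c where "x = (\<Sum>i\<in>A. c i *\<^sub>R g i)"
proof -
  let ?R = "range (\<lambda>c. \<Sum>i\<in>A. c i *\<^sub>R g i)"
  have "span (g ` A) \<subseteq> ?R"
  proof (rule span_minimal)
    show "subspace ?R"
    proof (rule subspaceI)
      show "0 \<in> ?R" by (rule range_eqI[of _ _ "\<lambda>_. 0"]) simp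
    next
      fix y z assume "y \<in> ?R" "z \<in> ?R"
      then obtain b c where "y = (\<Sum>i\<in>A. b i *\<^sub>R g i)" "z = (\<Sum>i\<in>A. c i *\<^sub>R g i)" by blast
      then have "y + z = (\<Sum>i\<in>A. (b i + c i) *\<^sub>R g i)" by (simp add: scaleR_add_left sum.distrib)
      then show "y + z \<in> ?R" by (rule range_eqI[where x = "\<lambda>i. b i + c i"])
    next
      fix k y assume "y \<in> ?R"
      then obtain c where "y = (\<Sum>i\<in>A. c i *\<^sub>R g i)" by blast
      then have "k *\<^sub>R y = (\<Sum>i\<in>A. (k * c i) *\<^sub>R g i)" by (simp add: scaleR_sum_right)
      then show "k *\<^sub>R y \<in> ?R" by (rule range_eqI[where x = "\<lambda>i. k * c i"])
    qed
  next
    show "g ` A \<subseteq> ?R"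
    proof
      fix y assume "y \<in> g ` A"
      then obtain j where j: "j \<in> A" "y = g j" by blast
      have "y = (\<Sum>i\<in>A. if j = i then g i else 0)" using assms(1) j by simp
      also have "\<dots> = (\<Sum>i\<in>A. (if j = i then 1 else 0) *\<^sub>R g i)" by (intro sum.cong) auto
      finally show "y \<in> ?R" by (rule range_eqI[where x = "\<lambda>i. if j = i then 1 else 0"])
    qed
  qed
  with assms(2) that show ?thesis by blast
qed

locale graph_with_tubing = graph +
  fixes \<T>\<^sub>0 :: "'a set set"
  assumes maximal: "maximal_tubing G \<T>\<^sub>0"
begin

lemma tubing0: "tubing G \<T>\<^sub>0"
  using maximal by (simp add: maximal_tubing_def)

lemmas tube0 = tubing_tube[OF tubing0]
lemmas finite0 = tubing_finite[OF tubing0]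

lemma cases0 [consumes 2, case_names sub sup apart]:
  assumes "S \<in> \<T>\<^sub>0" "T \<in> \<T>\<^sub>0"
  obtains "S \<subseteq> T" | "T \<subseteq> S" | "S \<inter> T = {}" "\<not> (\<exists>a\<in>S. \<exists>b\<in>T. a \<rightarrow>\<^bsub>G\<^esub> b)"
  using tubing_cases[OF tubing0 assms] by metis

definition nbh :: "'a set \<Rightarrow> 'a set" where
  "nbh S = {x. x \<notin> S \<and> (\<exists>u\<in>S. u \<rightarrow>\<^bsub>G\<^esub> x)}"

definition e :: "'a set \<Rightarrow> 'a set \<Rightarrow> real" where
  "e S = (\<lambda>R. of_bool (R = S))"

definition f :: "'a \<Rightarrow> 'a set \<Rightarrow> real" where
  "f x = (\<lambda>R. of_bool (R \<in> \<T>\<^sub>0 \<and> x \<in> nbh R))"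

text \<open>The amount by which \<open>\<Sum>x\<in>T. f x\<close> exceeds \<open>d T\<close> in the coordinate \<open>S \<subseteq> T\<close>.\<close>

definition a :: "'a set \<Rightarrow> 'a set \<Rightarrow> real" where
  "a S T = real (card (T \<inter> nbh S)) + of_bool (S = T)"

abbreviation d :: "'a set \<Rightarrow> 'a set \<Rightarrow> real" where
  "d \<equiv> compat_vector G \<T>\<^sub>0"

definition M :: "'a set \<Rightarrow> ('a set \<Rightarrow> real) set" where
  "M Y = span (e ` {S \<in> \<T>\<^sub>0. S \<subseteq> Y} \<union> f ` Y)"

text \<open>In coordinate \<open>R\<close> the first sum counts \<open>T \<inter> nbh R\<close>.
  That is the compatibility degree unless \<open>R \<subseteq> T\<close>, where \<open>a R T\<close>
  corrects it to 0, or to -1 if \<open>R = T\<close>.\<close>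

lemma compat_vector_eq:
  assumes "tube G T"
  shows "d T = (\<Sum>x\<in>T. f x) - (\<Sum>S\<in>{S \<in> \<T>\<^sub>0. S \<subseteq> T}. a S T *\<^sub>R e S)"
proof
  fix R
  have fin: "finite T" using assms by (rule tube_finite)
  show "d T R = ((\<Sum>x\<in>T. f x) - (\<Sum>S\<in>{S \<in> \<T>\<^sub>0. S \<subseteq> T}. a S T *\<^sub>R e S)) R"
  proof (cases "R \<in> \<T>\<^sub>0")
    case True
    have "(\<Sum>x\<in>T. f x R) = real (card (T \<inter> nbh R))"
      using fin True by (simp add: f_def of_bool_def sum.If_cases Int_def)
    moreover have "(\<Sum>S\<in>{S \<in> \<T>\<^sub>0. S \<subseteq> T}. (a S T *\<^sub>R e S) R) = (if R \<subseteq> T then a R T else 0)"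
    proof -
      have "(\<Sum>S\<in>{S \<in> \<T>\<^sub>0. S \<subseteq> T}. (a S T *\<^sub>R e S) R)
          = (\<Sum>S\<in>{S \<in> \<T>\<^sub>0. S \<subseteq> T}. if R = S then a S T else 0)"
        by (intro sum.cong) (auto simp: scaleR_fun_def e_def)
      then show ?thesis using finite0 True by (simp add: sum.delta)
    qed
    moreover have "{v \<in> T - R. \<exists>u\<in>R. u \<rightarrow>\<^bsub>G\<^esub> v} = T \<inter> nbh R" by (auto simp: nbh_def)
    moreover have "T \<inter> nbh T = {}" by (auto simp: nbh_def)
    ultimately show ?thesis using True
      by (auto simp: sum_fun_apply compat_vector_def compat_degree_def a_def)
  next
    case False
    then have "(\<Sum>S\<in>{S \<in> \<T>\<^sub>0. S \<subseteq> T}. (a S T *\<^sub>R e S) R) = 0"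
      by (intro sum.neutral) (auto simp: scaleR_fun_def e_def)
    then show ?thesis using False by (simp add: sum_fun_apply compat_vector_def f_def)
  qed
qed

lemma f_eq_sum: "f x = (\<Sum>D\<in>{D \<in> \<T>\<^sub>0. x \<in> nbh D}. e D)"
proof
  fix R
  have "(\<Sum>D\<in>{D \<in> \<T>\<^sub>0. x \<in> nbh D}. e D R) = (\<Sum>D\<in>{D \<in> \<T>\<^sub>0. x \<in> nbh D}. if R = D then 1 else 0)"
    by (intro sum.cong) (auto simp: e_def)
  then show "f x R = (\<Sum>D\<in>{D \<in> \<T>\<^sub>0. x \<in> nbh D}. e D) R"
    using finite0 by (simp add: sum_fun_apply f_def)
qed

lemma e_in_M: "S \<in> \<T>\<^sub>0 \<Longrightarrow> S \<subseteq> Y \<Longrightarrow> e S \<in> M Y"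
  unfolding M_def by (intro span_base) auto

lemma f_in_M: "x \<in> Y \<Longrightarrow> f x \<in> M Y"
  unfolding M_def by (intro span_base) auto

lemma M_add: "p \<in> M Y \<Longrightarrow> q \<in> M Y \<Longrightarrow> p + q \<in> M Y"
  and M_diff: "p \<in> M Y \<Longrightarrow> q \<in> M Y \<Longrightarrow> p - q \<in> M Y"
  and M_scale: "p \<in> M Y \<Longrightarrow> c *\<^sub>R p \<in> M Y"
  and M_sum: "(\<And>i. i \<in> A \<Longrightarrow> g i \<in> M Y) \<Longrightarrow> sum g A \<in> M Y"
  unfolding M_def by (auto intro: span_add span_diff span_scale span_sum)

text \<open>An edge of \<open>T\<close> leaving \<open>S\<close> supplies a neighbour. Strict
  positivity is the source of the equal signs in the flip property.\<close>

lemma a_pos: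
  assumes "tube G S" "tube G T" "S \<subseteq> T"
  shows "a S T > 0"
proof (cases "S = T")
  case False
  obtain y z where "y \<in> T \<inter> S" "z \<in> T - S" using assms tube_nonempty[OF assms(1)] False by blast
  then obtain x y where "x \<in> T \<inter> S" "y \<in> T - S" "x \<rightarrow>\<^bsub>G\<^esub> y" by (rule tube_edgeE[OF assms(2)])
  then have "y \<in> T \<inter> nbh S" by (auto simp: nbh_def)
  moreover have "finite (T \<inter> nbh S)" using tube_finite[OF assms(2)] by simp
  ultimately have "card (T \<inter> nbh S) > 0" by (auto simp: card_gt_0_iff)
  then show ?thesis by (simp add: a_def)
qed (simp add: a_def)

text \<open>Modulo \<open>M Y\<close>, only the terms indexed by \<open>Z\<close> and
  \<open>\<Z>\<close> survive in the expansion of \<open>d T\<close>.\<close>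

lemma d_reduce:
  assumes T: "tube G T" and Z: "Z \<subseteq> T" "T - Z \<subseteq> Y" and \<Z>: "\<Z> \<subseteq> {S \<in> \<T>\<^sub>0. S \<subseteq> T}"
    and rest: "\<And>S. S \<in> \<T>\<^sub>0 \<Longrightarrow> S \<subseteq> T \<Longrightarrow> S \<notin> \<Z> \<Longrightarrow> e S \<in> M Y"
  shows "d T - (\<Sum>x\<in>Z. f x) + (\<Sum>S\<in>\<Z>. a S T *\<^sub>R e S) \<in> M Y"
proof -
  let ?A = "{S \<in> \<T>\<^sub>0. S \<subseteq> T}"
  have "finite T" "finite ?A" using tube_finite[OF T] finite0 by auto
  then have "(\<Sum>x\<in>T. f x) = (\<Sum>x\<in>T - Z. f x) + (\<Sum>x\<in>Z. f x)"
    "(\<Sum>S\<in>?A. a S T *\<^sub>R e S) = (\<Sum>S\<in>?A - \<Z>. a S T *\<^sub>R e S) + (\<Sum>S\<in>\<Z>. a S T *\<^sub>R e S)"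
    using sum.subset_diff[OF Z(1)] sum.subset_diff[OF \<Z>] by blast+
  then have "d T - (\<Sum>x\<in>Z. f x) + (\<Sum>S\<in>\<Z>. a S T *\<^sub>R e S)
      = (\<Sum>x\<in>T - Z. f x) - (\<Sum>S\<in>?A - \<Z>. a S T *\<^sub>R e S)"
    unfolding compat_vector_eq[OF T] by simp
  moreover have "(\<Sum>x\<in>T - Z. f x) \<in> M Y" using Z by (intro M_sum f_in_M) auto
  moreover have "(\<Sum>S\<in>?A - \<Z>. a S T *\<^sub>R e S) \<in> M Y" using rest by (intro M_sum M_scale) auto
  ultimately show ?thesis using M_diff by simp
qed

lemma d_in_M:
  assumes "tube G T" "T \<subseteq> Y"
  shows "d T \<in> M Y"
  using d_reduce[OF assms(1), of "{}" Y "{}"] assms(2) by (auto intro: e_in_M)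

lemma d_reduce_no_top:
  assumes "tube G T" "v \<in> T" "T - {v} \<subseteq> Y" "\<And>S. S \<in> \<T>\<^sub>0 \<Longrightarrow> v \<in> S \<Longrightarrow> \<not> S \<subseteq> T"
  shows "d T - f v \<in> M Y"
proof -
  have "d T - (\<Sum>x\<in>{v}. f x) + (\<Sum>S\<in>{}. a S T *\<^sub>R e S) \<in> M Y"
  proof (rule d_reduce)
    fix S assume "S \<in> \<T>\<^sub>0" "S \<subseteq> T"
    with assms show "e S \<in> M Y" by (intro e_in_M) auto
  qed (use assms in auto)
  then show ?thesis by simp
qed

text \<open>Any \<open>D\<close> that has \<open>v\<close> as a neighbour is adjacent to
  \<open>S\<close> without containing \<open>v\<close>, so compatibility forces
  \<open>D \<subseteq> S - {v}\<close>.\<close>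

lemma f_in_M_of_tube:
  assumes S: "S \<in> \<T>\<^sub>0" and "v \<in> S" "S - {v} \<subseteq> Y"
  shows "f v \<in> M Y"
  unfolding f_eq_sum
proof (rule M_sum)
  fix D assume "D \<in> {D \<in> \<T>\<^sub>0. v \<in> nbh D}"
  then have D: "D \<in> \<T>\<^sub>0" "v \<notin> D" and edge: "\<exists>u\<in>D. u \<rightarrow>\<^bsub>G\<^esub> v" by (auto simp: nbh_def)
  have "D \<subseteq> S" using D(1) S by (cases rule: cases0) (use assms D edge in blast)+
  then show "e D \<in> M Y" using D assms by (intro e_in_M) auto
qed

section \<open>The initial tubing ordered by inclusion\<close>

definition child :: "'a set \<Rightarrow> 'a set \<Rightarrow> bool" where
  "child S Q \<longleftrightarrow> S \<in> \<T>\<^sub>0 \<and> Q \<in> \<T>\<^sub>0 \<and> S \<subset> Q \<and> (\<forall>R\<in>\<T>\<^sub>0. S \<subseteq> R \<and> R \<subset> Q \<longrightarrow> R = S)"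

lemma child_max: "child S Q \<Longrightarrow> R \<in> \<T>\<^sub>0 \<Longrightarrow> S \<subseteq> R \<Longrightarrow> R \<subset> Q \<Longrightarrow> R = S"
  by (simp add: child_def)

definition root :: "'a \<Rightarrow> 'a set \<Rightarrow> bool" where
  "root r Q \<longleftrightarrow> Q \<in> \<T>\<^sub>0 \<and> r \<in> Q \<and> \<Union>{S \<in> \<T>\<^sub>0. S \<subset> Q} = Q - {r}"

lemma root_exists:
  assumes "Q \<in> \<T>\<^sub>0" obtains r where "root r Q"
  using maximal_tubing_root[OF maximal assms] assms unfolding root_def by metis

lemma root_notin: "root r Q \<Longrightarrow> S \<in> \<T>\<^sub>0 \<Longrightarrow> S \<subset> Q \<Longrightarrow> r \<notin> S"
  unfolding root_def by blast

lemma child_containing: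
  assumes "root r Q" "x \<in> Q" "x \<noteq> r"
  obtains S where "child S Q" "x \<in> S"
proof -
  let ?F = "{S \<in> \<T>\<^sub>0. S \<subset> Q \<and> x \<in> S}"
  have "finite ?F" using finite0 by simp
  moreover have "x \<in> \<Union>{S \<in> \<T>\<^sub>0. S \<subset> Q}" using assms unfolding root_def by simp
  then have "?F \<noteq> {}" by blast
  ultimately have "\<exists>S\<in>?F. \<forall>R\<in>?F. S \<subseteq> R \<longrightarrow> S = R" by (rule finite_has_maximal)
  then obtain S where S: "S \<in> ?F" and max: "\<forall>R\<in>?F. S \<subseteq> R \<longrightarrow> S = R" by blast
  have "R = S" if "R \<in> \<T>\<^sub>0" "S \<subseteq> R" "R \<subset> Q" for R
  proof -
    have "R \<in> ?F" using S that by blast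
    from max[rule_format, OF this that(2)] show ?thesis by simp
  qed
  then have "child S Q" using S assms(1) unfolding child_def root_def by simp
  with S that show ?thesis by blast
qed

lemma child_cases:
  assumes "child S Q" "D \<in> \<T>\<^sub>0" "D \<subset> Q" "x \<in> S" "x \<in> D"
  shows "D \<subseteq> S"
proof -
  have "S \<in> \<T>\<^sub>0" using assms(1) by (simp add: child_def)
  with assms(2) show ?thesis
    by (cases rule: cases0) (use assms in \<open>auto simp: child_def\<close>)
qed

text \<open>An edge of \<open>Q\<close> leaving \<open>S\<close> cannot end in another child, which
  would be incompatible with \<open>S\<close>; only the root remains.\<close>

lemma root_adjacent_child:
  assumes "root r Q" "child S Q"
  shows "r \<in> nbh S"
proof -
  have S: "S \<in> \<T>\<^sub>0" "S \<subset> Q" and Q: "Q \<in> \<T>\<^sub>0" using assms(2) by (auto simp: child_def)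
  obtain x y where "x \<in> Q \<inter> S" "y \<in> Q - S"
    using S tube_nonempty[OF tube0[OF S(1)]] by blast
  then obtain x y where xy: "x \<in> Q \<inter> S" "y \<in> Q - S" "x \<rightarrow>\<^bsub>G\<^esub> y" by (rule tube_edgeE[OF tube0[OF Q]])
  have "y = r"
  proof (rule ccontr)
    assume "y \<noteq> r"
    then obtain R where R: "child R Q" "y \<in> R" using child_containing[OF assms(1)] xy by blast
    then have "R \<in> \<T>\<^sub>0" "R \<subset> Q" by (auto simp: child_def)
    with S(1) show False
    proof (cases rule: cases0)
      case sub
      then have "R = S" using child_max[OF assms(2) \<open>R \<in> \<T>\<^sub>0\<close>] \<open>R \<subset> Q\<close> by simp
      then show False using R xy by blast
    next
      case sup
      then show False using R xy by blast
    next
      case apart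
      then show False using R xy by blast
    qed
  qed
  then show ?thesis using xy by (auto simp: nbh_def)
qed

text \<open>A tube having \<open>r\<close> as a neighbour must lie strictly inside \<open>Q\<close>,
  and every child of \<open>Q\<close> is such a tube. So \<open>f r\<close> reduces to the children
  not already known to vanish.\<close>

lemma f_root_reduce:
  assumes r: "root r Q" and \<C>: "\<And>S. S \<in> \<C> \<Longrightarrow> child S Q"
    and rest: "\<And>D. D \<in> \<T>\<^sub>0 \<Longrightarrow> D \<subset> Q \<Longrightarrow> D \<notin> \<C> \<Longrightarrow> e D \<in> M Y"
  shows "f r - (\<Sum>S\<in>\<C>. e S) \<in> M Y"
proof -
  let ?N = "{D \<in> \<T>\<^sub>0. r \<in> nbh D}"
  have Q: "Q \<in> \<T>\<^sub>0" "r \<in> Q" using r by (auto simp: root_def)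
  have "\<C> \<subseteq> ?N" using \<C> root_adjacent_child[OF r] by (auto simp: child_def)
  moreover have "finite ?N" using finite0 by simp
  ultimately have "(\<Sum>D\<in>?N. e D) = (\<Sum>D\<in>?N - \<C>. e D) + (\<Sum>D\<in>\<C>. e D)"
    by (rule sum.subset_diff)
  then have "f r - (\<Sum>S\<in>\<C>. e S) = (\<Sum>D\<in>?N - \<C>. e D)" unfolding f_eq_sum by simp
  also have "\<dots> \<in> M Y"
  proof (intro M_sum rest)
    fix D assume "D \<in> ?N - \<C>"
    then have D: "D \<in> \<T>\<^sub>0" "r \<notin> D" "\<exists>u\<in>D. u \<rightarrow>\<^bsub>G\<^esub> r" by (auto simp: nbh_def)
    from D(1) Q(1) show "D \<subset> Q" by (cases rule: cases0) (use D Q in blast)+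
  qed auto
  finally show ?thesis .
qed

text \<open>Let \<open>Q\<close> be the parent of \<open>S\<close> and \<open>r\<close> its root.
  Then \<open>r\<close> differs from \<open>v\<close>, so \<open>f r\<close> is in
  \<open>M Y\<close>. Besides \<open>e S\<close>, it involves only tubes avoiding \<open>v\<close>
  and tubes through \<open>v\<close> strictly inside \<open>S\<close>, which the induction
  handles.\<close>

lemma e_in_M_of_larger:
  assumes "S \<in> \<T>\<^sub>0" "S' \<in> \<T>\<^sub>0" "v \<in> S" "S \<subset> S'" "S' - {v} \<subseteq> Y"
  shows "e S \<in> M Y"
  using assms
proof (induction "card S" arbitrary: S S' rule: less_induct)
  case less
  let ?F = "{Q \<in> \<T>\<^sub>0. S \<subset> Q \<and> Q \<subseteq> S'}"
  have "finite ?F" "?F \<noteq> {}" using finite0 less.prems by auto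
  from finite_has_minimal[OF this]
  obtain Q where "Q \<in> ?F" and min: "\<forall>R\<in>?F. R \<subseteq> Q \<longrightarrow> Q = R" by blast
  then have Q: "Q \<in> \<T>\<^sub>0" "S \<subset> Q" "Q \<subseteq> S'" by auto
  have "R = S" if R: "R \<in> \<T>\<^sub>0" "S \<subseteq> R" "R \<subset> Q" for R
  proof (rule ccontr)
    assume "R \<noteq> S"
    then have "R \<in> ?F" using R Q by blast
    then show False using min R by blast
  qed
  then have ch: "child S Q" using Q less.prems(1) unfolding child_def by blast
  obtain r where r: "root r Q" using root_exists Q by blast
  have "r \<in> Q" "r \<notin> S" using r root_notin[OF r less.prems(1) Q(2)] by (auto simp: root_def)
  then have rY: "r \<in> Y" using Q(3) less.prems(3,5) by blast
  have "f r - (\<Sum>S\<in>{S}. e S) \<in> M Y"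
  proof (rule f_root_reduce[OF r])
    fix D assume D: "D \<in> \<T>\<^sub>0" "D \<subset> Q" "D \<notin> {S}"
    show "e D \<in> M Y"
    proof (cases "v \<in> D")
      case True
      then have "D \<subset> S" using child_cases[OF ch D(1,2)] less.prems D(3) by blast
      moreover have "card D < card S"
        using calculation tube_finite[OF tube0[OF less.prems(1)]] by (simp add: psubset_card_mono)
      ultimately show ?thesis using less.hyps[of D S] D(1) True less.prems by blast
    next
      case False
      then show ?thesis using D Q less.prems by (intro e_in_M) auto
    qed
  qed (use ch in simp)
  then have "f r - e S \<in> M Y" by simp
  from M_diff[OF f_in_M[OF rY] this] show ?case by simp
qed

text \<open>Here \<open>T\<close> is a component: a connected set with an edge into \<open>T\<close>
  lies entirely in \<open>T\<close>, so no coordinate is nonzero. This disposes of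
  \<open>d (T \<union> T')\<close> when the union is not proper.\<close>

lemma d_eq_0:
  assumes "tube G T" "\<not> proper_tube G T"
  shows "d T = 0"
proof
  fix S
  show "d T S = 0 S"
  proof (cases "S \<in> \<T>\<^sub>0")
    case True
    then have "proper_tube G S" using tubing0 by (simp add: tubing_def)
    then have "S \<noteq> T" using assms by blast
    moreover have "card {v \<in> T - S. \<exists>u\<in>S. u \<rightarrow>\<^bsub>G\<^esub> v} = 0" if nsub: "\<not> S \<subseteq> T"
    proof (rule ccontr)
      assume "\<not> ?thesis"
      then have "{v \<in> T - S. \<exists>u\<in>S. u \<rightarrow>\<^bsub>G\<^esub> v} \<noteq> {}" by (metis card.empty)
      then obtain u v where uv: "u \<in> S" "v \<in> T" "v \<notin> S" "u \<rightarrow>\<^bsub>G\<^esub> v" by blast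
      then have "v \<rightarrow>\<^bsub>G\<^esub> u" by (simp add: graph_symmetric)
      have closed: "\<And>a b. a \<in> T \<Longrightarrow> a \<rightarrow>\<^bsub>G\<^esub> b \<Longrightarrow> b \<in> T" using assms unfolding proper_tube_iff by blast
      then have "u \<in> T" using uv \<open>v \<rightarrow>\<^bsub>G\<^esub> u\<close> by blast
      obtain b where "u \<in> S \<inter> T" "b \<in> S - T" using nsub \<open>u \<in> T\<close> uv(1) by blast
      then obtain x y where "x \<in> S \<inter> T" "y \<in> S - T" "x \<rightarrow>\<^bsub>G\<^esub> y" by (rule tube_edgeE[OF tube0[OF True]])
      then show False using closed by blast
    qed
    ultimately show ?thesis by (simp add: compat_vector_def compat_degree_def)
  qed (simp add: compat_vector_def)
qed

lemma d_reduce_top: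
  assumes T: "tube G T" "T - {v} \<subseteq> Y" and S: "S \<in> \<T>\<^sub>0" "v \<in> S" "S \<subseteq> T"
    and top: "\<And>R. R \<in> \<T>\<^sub>0 \<Longrightarrow> v \<in> R \<Longrightarrow> R \<subseteq> T \<Longrightarrow> R \<subseteq> S"
  shows "d T + a S T *\<^sub>R e S \<in> M Y"
proof -
  have SY: "S - {v} \<subseteq> Y" using S T by blast
  have "d T - (\<Sum>x\<in>{v}. f x) + (\<Sum>R\<in>{S}. a R T *\<^sub>R e R) \<in> M Y"
  proof (rule d_reduce[OF T(1)])
    fix R assume R: "R \<in> \<T>\<^sub>0" "R \<subseteq> T" "R \<notin> {S}"
    show "e R \<in> M Y"
    proof (cases "v \<in> R")
      case True
      then have "R \<subset> S" using top R by blast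
      then show ?thesis by (rule e_in_M_of_larger[OF R(1) S(1) True _ SY])
    next
      case False
      then show ?thesis using R T by (intro e_in_M) auto
    qed
  qed (use S T in auto)
  from M_add[OF this f_in_M_of_tube[OF S(1,2) SY]] show ?thesis by simp
qed

lemma top_exists:
  assumes "S \<in> \<T>\<^sub>0" "v \<in> S" "S \<subseteq> T"
  obtains S' where "S' \<in> \<T>\<^sub>0" "v \<in> S'" "S' \<subseteq> T" "\<And>R. R \<in> \<T>\<^sub>0 \<Longrightarrow> v \<in> R \<Longrightarrow> R \<subseteq> T \<Longrightarrow> R \<subseteq> S'"
proof -
  let ?F = "{S \<in> \<T>\<^sub>0. v \<in> S \<and> S \<subseteq> T}"
  have "finite ?F" "?F \<noteq> {}" using finite0 assms by auto
  then have "\<exists>S'\<in>?F. \<forall>R\<in>?F. S' \<subseteq> R \<longrightarrow> S' = R" by (rule finite_has_maximal)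
  then obtain S' where S': "S' \<in> ?F" and max: "\<forall>R\<in>?F. S' \<subseteq> R \<longrightarrow> S' = R" by blast
  have "R \<subseteq> S'" if R: "R \<in> \<T>\<^sub>0" "v \<in> R" "R \<subseteq> T" for R
  proof -
    have "R \<in> ?F" "S' \<in> \<T>\<^sub>0" using R S' by auto
    from R(1) this(2) show ?thesis
    proof (cases rule: cases0)
      case sup
      then show ?thesis using max[rule_format, OF \<open>R \<in> ?F\<close>] by simp
    qed (use R S' in auto)
  qed
  with S' that show ?thesis by blast
qed

section \<open>The span property\<close>

text \<open>Stated for unions of tubes, to cover both a single tube and the set
  \<open>T \<union> T' - {v, w}\<close> of a flip. The induction removes the root \<open>v\<close>
  of a maximal tube \<open>U\<close> inside \<open>Y\<close>, which loses exactly the vector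
  \<open>d U\<close>.\<close>

lemma span_compat_vectors:
  assumes max: "maximal_tubing G \<T>" and \<S>: "\<S> \<subseteq> \<T>" "Y = \<Union>\<S>"
  shows "span (d ` {S \<in> \<T>. S \<subseteq> Y}) = M Y"
  using \<S>
proof (induction "card Y" arbitrary: Y \<S> rule: less_induct)
  case less
  have tub: "tubing G \<T>" using max by (simp add: maximal_tubing_def)
  have finY: "finite Y"
    using less.prems tubing_tube[OF tub] tube_finite finite_subset[OF less.prems(1) tubing_finite[OF tub]] by blast
  show ?case
  proof (cases "Y = {}")
    case True
    have "S \<noteq> {}" if "S \<in> \<T>" for S using tube_nonempty tubing_tube[OF tub that] by blast
    moreover have "S \<noteq> {}" if "S \<in> \<T>\<^sub>0" for S using tube_nonempty tube0 that by blast
    ultimately have empty: "{S \<in> \<T>. S \<subseteq> {}} = {}" "{S \<in> \<T>\<^sub>0. S \<subseteq> {}} = {}" by blast+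
    show ?thesis unfolding True M_def empty by simp
  next
    case False
    let ?F = "{S \<in> \<T>. S \<subseteq> Y}"
    have "\<exists>S. S \<in> ?F" using False less.prems by blast
    then have "finite ?F" "?F \<noteq> {}" using tubing_finite[OF tub] by auto
    then have "\<exists>U\<in>?F. \<forall>R\<in>?F. U \<subseteq> R \<longrightarrow> U = R" by (rule finite_has_maximal)
    then obtain U where "U \<in> ?F" and "\<forall>R\<in>?F. U \<subseteq> R \<longrightarrow> U = R" by blast
    then have U: "U \<in> \<T>" "U \<subseteq> Y" and Umax: "\<And>R. R \<in> \<T> \<Longrightarrow> R \<subseteq> Y \<Longrightarrow> U \<subseteq> R \<Longrightarrow> R = U"
      by auto
    obtain v where v: "v \<in> U" "\<Union>{S \<in> \<T>. S \<subset> U} = U - {v}"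
      by (rule maximal_tubing_root[OF max U(1)])
    define Y' where "Y' = Y - {v}"
    have tubeU: "tube G U" using tubing_tube[OF tub U(1)] .
    have inU: "S \<subseteq> U \<or> S \<inter> U = {} \<and> \<not> (\<exists>a\<in>S. \<exists>b\<in>U. a \<rightarrow>\<^bsub>G\<^esub> b)" if "S \<in> \<T>" "S \<subseteq> Y" for S
      using tub that(1) U(1) by (cases rule: tubing_cases) (use Umax[OF that] in auto)
    have new: "{S \<in> \<T>. S \<subseteq> Y} = insert U {S \<in> \<T>. S \<subseteq> Y'}"
    proof -
      have "S = U" if S: "S \<in> \<T>" "S \<subseteq> Y" "v \<in> S" for S
      proof (rule ccontr)
        assume "S \<noteq> U"
        then have "S \<subset> U" using inU[OF S(1,2)] S(3) v(1) by blast
        then show False using v(2) S by blast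
      qed
      then show ?thesis using U v(1) unfolding Y'_def by blast
    qed
    have span': "span (d ` {S \<in> \<T>. S \<subseteq> Y'}) = M Y'"
    proof (rule less.hyps)
      show "card Y' < card Y" unfolding Y'_def using finY v U by (intro psubset_card_mono) auto
      show "Y' = \<Union>{S \<in> \<T>. S \<subseteq> Y'}"
      proof (intro equalityI subsetI)
        fix x assume x: "x \<in> Y'"
        show "x \<in> \<Union>{S \<in> \<T>. S \<subseteq> Y'}"
        proof (cases "x \<in> U")
          case True
          then have "x \<in> \<Union>{S \<in> \<T>. S \<subset> U}" using v(2) x Y'_def by simp
          then obtain S where S: "S \<in> \<T>" "S \<subset> U" "x \<in> S" by blast
          then have "S \<subseteq> U - {v}" using v(2) by blast
          then have "S \<subseteq> Y'" using U(2) Y'_def by blast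
          then show ?thesis using S by blast
        next
          case False
          obtain S where S: "S \<in> \<T>" "x \<in> S" "S \<subseteq> Y" using x less.prems Y'_def by blast
          then have "v \<notin> S" using inU[OF S(1,3)] False v(1) by blast
          then show ?thesis using S Y'_def by blast
        qed
      qed auto
    qed auto
    have IH: "M Y' \<subseteq> span (d ` {S \<in> \<T>. S \<subseteq> Y})"
      unfolding span'[symmetric] new by (intro span_mono) auto
    let ?V = "span (d ` {S \<in> \<T>. S \<subseteq> Y})"
    have dU: "d U \<in> ?V" using U by (intro span_base) auto
    have UY': "U - {v} \<subseteq> Y'" using U unfolding Y'_def by blast
    \<comment> \<open>\<open>U\<close> is a component of \<open>Y\<close>: an edge leaving it inside
      \<open>Y\<close> would reach another tube of \<open>\<T>\<close> apart from
      \<open>U\<close>.\<close>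
    have inside: "S \<subseteq> U" if S: "S \<in> \<T>\<^sub>0" "S \<subseteq> Y" "v \<in> S" for S
    proof (rule ccontr)
      assume "\<not> S \<subseteq> U"
      then obtain b where "v \<in> S \<inter> U" "b \<in> S - U" using S(3) v(1) by blast
      then obtain x y where xy: "x \<in> S \<inter> U" "y \<in> S - U" "x \<rightarrow>\<^bsub>G\<^esub> y" by (rule tube_edgeE[OF tube0[OF S(1)]])
      then obtain R where R: "R \<in> \<T>" "y \<in> R" "R \<subseteq> Y" using less.prems S(2) by blast
      have "y \<rightarrow>\<^bsub>G\<^esub> x" using xy(3) by (simp add: graph_symmetric)
      then show False using inU[OF R(1,3)] R(2) xy(1,2) by blast
    qed
    \<comment> \<open>These are the generators of \<open>M Y\<close> not already in
      \<open>M Y'\<close>; each comes from \<open>d U\<close> modulo \<open>M Y'\<close>.\<close>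
    have gens: "f v \<in> ?V \<and> (\<forall>S\<in>\<T>\<^sub>0. v \<in> S \<and> S \<subseteq> Y \<longrightarrow> e S \<in> ?V)"
    proof (cases "\<exists>S\<in>\<T>\<^sub>0. v \<in> S \<and> S \<subseteq> U")
      case False
      then have "d U - f v \<in> M Y'" by (intro d_reduce_no_top[OF tubeU v(1) UY']) blast
      then have "d U - (d U - f v) \<in> ?V" using IH dU span_diff by blast
      then have "f v \<in> ?V" by simp
      moreover have "e S \<in> ?V" if S: "S \<in> \<T>\<^sub>0" "v \<in> S \<and> S \<subseteq> Y" for S
        using False S inside[OF S(1)] by simp
      ultimately show ?thesis by simp
    next
      case True
      then obtain S0 where "S0 \<in> \<T>\<^sub>0" "v \<in> S0" "S0 \<subseteq> U" by blast
      then obtain S where S: "S \<in> \<T>\<^sub>0" "v \<in> S" "S \<subseteq> U"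
        and top: "\<And>R. R \<in> \<T>\<^sub>0 \<Longrightarrow> v \<in> R \<Longrightarrow> R \<subseteq> U \<Longrightarrow> R \<subseteq> S" by (rule top_exists) blast
      have SY': "S - {v} \<subseteq> Y'" using S(3) UY' by blast
      have "f v \<in> ?V" using f_in_M_of_tube[OF S(1,2) SY'] IH by blast
      moreover have eS: "e S \<in> ?V"
      proof -
        have pos: "a S U > 0" by (rule a_pos[OF tube0[OF S(1)] tubeU S(3)])
        have "d U + a S U *\<^sub>R e S \<in> ?V"
          using d_reduce_top[OF tubeU UY' S top] IH by blast
        from span_scale[OF span_diff[OF this dU], of "1 / a S U"] pos show ?thesis by simp
      qed
      moreover have "e R \<in> ?V" if R: "R \<in> \<T>\<^sub>0" "v \<in> R" "R \<subseteq> Y" for R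
      proof (cases "R = S")
        case False
        then have "R \<subset> S" using top[OF R(1,2) inside[OF R(1,3,2)]] by blast
        then show ?thesis using e_in_M_of_larger[OF R(1) S(1) R(2) _ SY'] IH by blast
      qed (use eS in simp)
      ultimately show ?thesis by blast
    qed
    have "e S \<in> ?V" if "S \<in> \<T>\<^sub>0" "S \<subseteq> Y" for S
      using that gens e_in_M[OF that(1), of Y'] IH unfolding Y'_def by blast
    moreover have "f x \<in> ?V" if "x \<in> Y" for x
      using that gens f_in_M[of x Y'] IH unfolding Y'_def by (cases "x = v") auto
    ultimately have "M Y \<subseteq> ?V" unfolding M_def by (intro span_minimal) auto
    moreover have "?V \<subseteq> M Y"
      using d_in_M tubing_tube[OF tub] by (intro span_minimal) (auto simp: M_def)
    ultimately show ?thesis by blast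
  qed
qed

section \<open>The flip relation modulo \<open>M (T \<union> T' - {v, w})\<close>\<close>

text \<open>\<open>S\<close> is the topmost initial tube through \<open>v\<close> inside
  \<open>T\<close>: such a tube avoids \<open>w\<close>, hence lies strictly inside \<open>Q\<close>
  and then inside the child \<open>S\<close>.\<close>

lemma flip_top:
  assumes fp: "flip_pair v w T T'" and Q: "root r Q" "w \<in> Q" "Q \<subseteq> T \<union> T'"
    and S: "child S Q" "v \<in> S" "w \<notin> S"
  defines "Y \<equiv> T \<union> T' - {v, w}"
  shows "S \<subseteq> T" and "d T + a S T *\<^sub>R e S \<in> M Y"
    and "\<And>D. D \<in> \<T>\<^sub>0 \<Longrightarrow> D \<subset> Q \<Longrightarrow> v \<in> D \<Longrightarrow> D \<noteq> S \<Longrightarrow> e D \<in> M Y"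
proof -
  note fp = flip_pairD[OF fp]
  have S': "S \<in> \<T>\<^sub>0" "S \<subset> Q" and Q': "Q \<in> \<T>\<^sub>0" using S by (auto simp: child_def)
  show ST: "S \<subseteq> T" using fp(8)[OF tube0[OF S'(1)]] S S' Q(3) by blast
  have "R \<subseteq> S" if R: "R \<in> \<T>\<^sub>0" "v \<in> R" "R \<subseteq> T" for R
  proof -
    from R(1) Q' have "R \<subset> Q" by (cases rule: cases0) (use R Q fp S S' in auto)
    then show ?thesis using child_cases[OF S(1) R(1)] R(2) S(2) by blast
  qed
  then show "d T + a S T *\<^sub>R e S \<in> M Y"
    unfolding Y_def by (intro d_reduce_top[OF fp(1,9) S'(1) S(2) ST])
  fix D assume D: "D \<in> \<T>\<^sub>0" "D \<subset> Q" "v \<in> D" "D \<noteq> S"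
  then have "D \<subset> S" using child_cases[OF S(1) D(1,2) S(2) D(3)] by blast
  moreover have "S - {v} \<subseteq> Y" using ST fp(9) unfolding Y_def by blast
  ultimately show "e D \<in> M Y" using e_in_M_of_larger[OF D(1) S'(1) D(3)] by blast
qed

text \<open>An initial tube through \<open>w\<close> inside \<open>T'\<close> would lie strictly
  inside \<open>Q\<close>, whose root is \<open>w\<close>. So \<open>d T'\<close> reduces to
  \<open>f w\<close>, which equals \<open>e S\<close> modulo \<open>M Y\<close>.\<close>

lemma flip_relation_root:
  assumes fp: "flip_pair v w T T'" and Q: "root w Q" "v \<in> Q" "Q \<subseteq> T \<union> T'"
  defines "Y \<equiv> T \<union> T' - {v, w}"
  obtains \<alpha> where "\<alpha> > 0" "d T + \<alpha> *\<^sub>R d T' \<in> M Y"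
proof -
  note fp' = flip_pairD[OF fp]
  have vw: "v \<noteq> w" using fp' by blast
  have Q': "Q \<in> \<T>\<^sub>0" "w \<in> Q" using Q(1) by (auto simp: root_def)
  obtain S where S: "child S Q" "v \<in> S" by (rule child_containing[OF Q(1,2) vw])
  then have S': "S \<in> \<T>\<^sub>0" "S \<subset> Q" by (auto simp: child_def)
  have "w \<notin> S" by (rule root_notin[OF Q(1) S'])
  note top = flip_top[OF fp Q(1) Q'(2) Q(3) S this, folded Y_def]
  have "f w - (\<Sum>S\<in>{S}. e S) \<in> M Y"
  proof (rule f_root_reduce[OF Q(1)])
    fix D assume D: "D \<in> \<T>\<^sub>0" "D \<subset> Q" "D \<notin> {S}"
    show "e D \<in> M Y"
    proof (cases "v \<in> D")
      case False
      have "w \<notin> D" by (rule root_notin[OF Q(1) D(1,2)])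
      then show ?thesis using D Q(3) False by (intro e_in_M) (auto simp: Y_def)
    qed (use top(3) D in simp)
  qed (use S in simp)
  then have 1: "f w - e S \<in> M Y" by simp
  have "\<not> R \<subseteq> T'" if R: "R \<in> \<T>\<^sub>0" "w \<in> R" for R
  proof
    assume RT: "R \<subseteq> T'"
    from R(1) Q'(1) have "R \<subset> Q" by (cases rule: cases0) (use R Q Q' RT fp' in auto)
    then show False using root_notin[OF Q(1) R(1)] R(2) by blast
  qed
  then have 2: "d T' - f w \<in> M Y"
    unfolding Y_def by (intro d_reduce_no_top[OF fp'(2,6,10)])
  have "d T + a S T *\<^sub>R d T' = (d T + a S T *\<^sub>R e S) + a S T *\<^sub>R ((d T' - f w) + (f w - e S))"
    by (simp add: algebra_simps)
  also have "\<dots> \<in> M Y" by (rule M_add[OF top(2) M_scale[OF M_add[OF 2 1]]])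
  finally show ?thesis using that a_pos[OF tube0[OF S'(1)] fp'(1) top(1)] by blast
qed

lemma flip_relation_other:
  assumes fp: "flip_pair v w T T'" and Q: "root r Q" "v \<in> Q" "w \<in> Q" "Q \<subseteq> T \<union> T'"
    and min: "\<And>R. R \<in> \<T>\<^sub>0 \<Longrightarrow> v \<in> R \<Longrightarrow> w \<in> R \<Longrightarrow> \<not> R \<subset> Q" and r: "r \<noteq> v" "r \<noteq> w"
  defines "Y \<equiv> T \<union> T' - {v, w}"
  obtains \<alpha> \<alpha>' where "\<alpha> > 0" "\<alpha>' > 0" "\<alpha> *\<^sub>R d T + \<alpha>' *\<^sub>R d T' \<in> M Y"
proof -
  note fp' = flip_pairD[OF fp]
  have Y': "T' \<union> T - {w, v} = Y" by (auto simp: Y_def)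
  have Q4: "Q \<subseteq> T' \<union> T" using Q(4) by blast
  obtain S where S: "child S Q" "v \<in> S" by (rule child_containing[OF Q(1,2) r(1)[symmetric]])
  obtain R where R: "child R Q" "w \<in> R" by (rule child_containing[OF Q(1,3) r(2)[symmetric]])
  have S': "S \<in> \<T>\<^sub>0" "S \<subset> Q" and R': "R \<in> \<T>\<^sub>0" "R \<subset> Q" using S R by (auto simp: child_def)
  \<comment> \<open>By minimality of \<open>Q\<close>, its children through \<open>v\<close> and
    through \<open>w\<close> are different.\<close>
  have wS: "w \<notin> S" and vR: "v \<notin> R" using min[OF S'(1)] min[OF R'(1)] S R S' R' by blast+
  note topS = flip_top[OF fp Q(1,3,4) S wS, folded Y_def]
  note topR = flip_top[OF flip_pair_sym[OF fp] Q(1,2) Q4 R vR, unfolded Y']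
  have "f r - (\<Sum>S\<in>{S, R}. e S) \<in> M Y"
  proof (rule f_root_reduce[OF Q(1)])
    fix D assume D: "D \<in> \<T>\<^sub>0" "D \<subset> Q" "D \<notin> {S, R}"
    show "e D \<in> M Y"
    proof (cases "v \<in> D \<or> w \<in> D")
      case True
      then show ?thesis using topS(3)[OF D(1,2)] topR(3)[OF D(1,2)] D(3) by blast
    next
      case False
      then show ?thesis using D Q(4) by (intro e_in_M) (auto simp: Y_def)
    qed
  qed (use S R in auto)
  moreover have "S \<noteq> R" using S wS R by blast
  ultimately have "f r - (e S + e R) \<in> M Y" by simp
  moreover have "f r \<in> M Y" using Q r by (intro f_in_M) (auto simp: Y_def root_def)
  ultimately have 1: "e S + e R \<in> M Y" using M_diff by fastforce
  let ?a = "a S T" and ?b = "a R T'"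
  \<comment> \<open>Cross-multiplying gives \<open>e S\<close> and \<open>e R\<close> the same
    coefficient, so that \<open>e S + e R\<close> can be eliminated.\<close>
  have "?b *\<^sub>R d T + ?a *\<^sub>R d T'
      = ?b *\<^sub>R (d T + ?a *\<^sub>R e S) + ?a *\<^sub>R (d T' + ?b *\<^sub>R e R) - (?a * ?b) *\<^sub>R (e S + e R)"
    by (simp add: algebra_simps)
  also have "\<dots> \<in> M Y" by (rule M_diff[OF M_add[OF M_scale[OF topS(2)] M_scale[OF topR(2)]] M_scale[OF 1]])
  finally show ?thesis
    using that a_pos[OF tube0[OF S'(1)] fp'(1) topS(1)] a_pos[OF tube0[OF R'(1)] fp'(2) topR(1)] by blast
qed

text \<open>When no tube of \<open>\<T>\<^sub>0\<close> inside \<open>T \<union> T'\<close> contains both \<open>v\<close> and \<open>w\<close>, the vector of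
  \<open>T \<union> T'\<close> splits modulo \<open>M Y\<close> into a part at \<open>v\<close> and a part at \<open>w\<close>; the part at \<open>v\<close> is a positive
  multiple of \<open>d T\<close>.\<close>

lemma flip_half:
  assumes fp: "flip_pair v w T T'"
    and no: "\<And>Q. Q \<in> \<T>\<^sub>0 \<Longrightarrow> v \<in> Q \<Longrightarrow> w \<in> Q \<Longrightarrow> \<not> Q \<subseteq> T \<union> T'"
  defines "Y \<equiv> T \<union> T' - {v, w}"
  defines "\<Z> \<equiv> {S \<in> \<T>\<^sub>0. S \<subseteq> T \<union> T' \<and> v \<in> S \<and> e S \<notin> M Y}"
  obtains \<alpha> where "\<alpha> > 0" "\<alpha> *\<^sub>R d T - (f v - (\<Sum>S\<in>\<Z>. a S (T \<union> T') *\<^sub>R e S)) \<in> M Y"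
proof -
  note fp' = flip_pairD[OF fp]
  let ?X = "T \<union> T'"
  have inT: "S \<subseteq> T" if "S \<in> \<T>\<^sub>0" "v \<in> S" "S \<subseteq> ?X" for S
    using fp'(8)[OF tube0] no that by blast
  show ?thesis
  proof (cases "\<exists>S\<in>\<T>\<^sub>0. v \<in> S \<and> S \<subseteq> T")
    case False
    then have "\<Z> = {}" using inT unfolding \<Z>_def by blast
    moreover have "d T - f v \<in> M Y"
      unfolding Y_def using False by (intro d_reduce_no_top[OF fp'(1,4,9)]) blast
    ultimately show ?thesis using that[of 1] by simp
  next
    case True
    then obtain S0 where "S0 \<in> \<T>\<^sub>0" "v \<in> S0" "S0 \<subseteq> T" by blast
    then obtain S where S: "S \<in> \<T>\<^sub>0" "v \<in> S" "S \<subseteq> T"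
      and top: "\<And>R. R \<in> \<T>\<^sub>0 \<Longrightarrow> v \<in> R \<Longrightarrow> R \<subseteq> T \<Longrightarrow> R \<subseteq> S" by (rule top_exists) blast
    have TY: "T - {v} \<subseteq> Y" using fp'(9) by (simp add: Y_def)
    have SY: "S - {v} \<subseteq> Y" using S(3) TY by blast
    have fv: "f v \<in> M Y" by (rule f_in_M_of_tube[OF S(1,2) SY])
    have dT: "d T + a S T *\<^sub>R e S \<in> M Y" by (rule d_reduce_top[OF fp'(1) TY S top])
    have "e R \<in> M Y" if R: "R \<in> \<T>\<^sub>0" "v \<in> R" "R \<subseteq> ?X" "R \<noteq> S" for R
    proof -
      have "R \<subset> S" using top[OF R(1,2) inT[OF R(1-3)]] R(4) by blast
      then show ?thesis by (rule e_in_M_of_larger[OF R(1) S(1) R(2) _ SY])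
    qed
    \<comment> \<open>Only the topmost \<open>S\<close> can survive, but \<open>e S\<close> may
      itself lie in \<open>M Y\<close>, so both possibilities are treated.\<close>
    then have \<Z>: "\<Z> = (if e S \<in> M Y then {} else {S})"
      using S unfolding \<Z>_def by auto
    have pos: "a S T > 0" "a S ?X > 0"
      using a_pos[OF tube0[OF S(1)]] fp'(1,3) S(3) by auto
    \<comment> \<open>Rescales the coefficient of \<open>e S\<close> from its value in
      \<open>d T\<close> to its value in \<open>d (T \<union> T')\<close>.\<close>
    define \<alpha> where "\<alpha> = a S ?X / a S T"
    have "\<alpha> *\<^sub>R d T - (f v - (\<Sum>S\<in>\<Z>. a S ?X *\<^sub>R e S)) \<in> M Y"
    proof (cases "e S \<in> M Y")
      case True
      have "\<alpha> *\<^sub>R d T - (f v - (\<Sum>S\<in>\<Z>. a S ?X *\<^sub>R e S))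
          = \<alpha> *\<^sub>R ((d T + a S T *\<^sub>R e S) - a S T *\<^sub>R e S) - f v" using \<Z> True by simp
      also have "\<dots> \<in> M Y" using True by (intro M_diff M_scale fv dT)
      finally show ?thesis .
    next
      case False
      have "\<alpha> *\<^sub>R d T - (f v - (\<Sum>S\<in>\<Z>. a S ?X *\<^sub>R e S))
          = \<alpha> *\<^sub>R (d T + a S T *\<^sub>R e S) - f v" using \<Z> False pos
        by (simp add: \<alpha>_def scaleR_add_right)
      also have "\<dots> \<in> M Y" by (intro M_diff M_scale fv dT)
      finally show ?thesis .
    qed
    moreover have "\<alpha> > 0" using pos by (simp add: \<alpha>_def)
    ultimately show ?thesis using that by blast
  qed
qed

text \<open>\<open>\<gamma>\<close> is 0 if some initial tube inside \<open>T \<union> T'\<close>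
  contains both \<open>v\<close> and \<open>w\<close>, and 1 otherwise.\<close>

lemma flip_relation:
  assumes fp: "flip_pair v w T T'"
  obtains \<alpha> \<alpha>' \<gamma> where "\<alpha> > 0" "\<alpha>' > 0"
    "\<alpha> *\<^sub>R d T + \<alpha>' *\<^sub>R d T' - \<gamma> *\<^sub>R d (T \<union> T') \<in> M (T \<union> T' - {v, w})"
proof -
  let ?X = "T \<union> T'"
  define Y where "Y = ?X - {v, w}"
  have Y': "T' \<union> T - {w, v} = Y" and Y'': "T \<union> T' - {w, v} = Y" by (auto simp: Y_def)
  note fp' = flip_pairD[OF fp]
  show ?thesis
  proof (cases "\<exists>Q\<in>\<T>\<^sub>0. v \<in> Q \<and> w \<in> Q \<and> Q \<subseteq> ?X")
    case True
    let ?F = "{Q \<in> \<T>\<^sub>0. v \<in> Q \<and> w \<in> Q \<and> Q \<subseteq> ?X}"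
    have "finite ?F" "?F \<noteq> {}" using finite0 True by auto
    then have "\<exists>Q\<in>?F. \<forall>R\<in>?F. R \<subseteq> Q \<longrightarrow> Q = R" by (rule finite_has_minimal)
    then obtain Q where Q: "Q \<in> ?F" "\<forall>R\<in>?F. R \<subseteq> Q \<longrightarrow> Q = R" by blast
    then have Q': "Q \<in> \<T>\<^sub>0" "v \<in> Q" "w \<in> Q" "Q \<subseteq> ?X" by auto
    then have Q'': "Q \<subseteq> T' \<union> T" by blast
    have min: "\<not> R \<subset> Q" if "R \<in> \<T>\<^sub>0" "v \<in> R" "w \<in> R" for R
    proof
      assume "R \<subset> Q"
      then have "R \<in> ?F" using that Q' by blast
      then show False using Q(2) \<open>R \<subset> Q\<close> by blast
    qed
    obtain r where r: "root r Q" by (rule root_exists[OF Q'(1)])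
    consider "r = w" | "r = v" | "r \<noteq> v" "r \<noteq> w" by blast
    then show ?thesis
    proof cases
      case 1
      with r have "root w Q" by simp
      then obtain \<alpha> where "\<alpha> > 0" "d T + \<alpha> *\<^sub>R d T' \<in> M Y"
        unfolding Y_def by (rule flip_relation_root[OF fp _ Q'(2,4)])
      then show ?thesis using that[of 1 \<alpha> 0] by (simp add: Y_def)
    next
      case 2
      with r have "root v Q" by simp
      then obtain \<alpha> where "\<alpha> > 0" "d T' + \<alpha> *\<^sub>R d T \<in> M Y"
        by (rule flip_relation_root[OF flip_pair_sym[OF fp] _ Q'(3) Q'', unfolded Y'])
      then show ?thesis using that[of \<alpha> 1 0] by (simp add: Y_def add.commute)
    next
      case 3
      then obtain \<alpha> \<alpha>' where "\<alpha> > 0" "\<alpha>' > 0" "\<alpha> *\<^sub>R d T + \<alpha>' *\<^sub>R d T' \<in> M Y"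
        using flip_relation_other[OF fp r Q'(2-4) min] unfolding Y_def by blast
      then show ?thesis using that[of \<alpha> \<alpha>' 0] by (simp add: Y_def)
    qed
  next
    case False
    then have no: "\<And>Q. Q \<in> \<T>\<^sub>0 \<Longrightarrow> v \<in> Q \<Longrightarrow> w \<in> Q \<Longrightarrow> \<not> Q \<subseteq> ?X" by blast
    then have no': "\<And>Q. Q \<in> \<T>\<^sub>0 \<Longrightarrow> w \<in> Q \<Longrightarrow> v \<in> Q \<Longrightarrow> \<not> Q \<subseteq> T' \<union> T" by blast
    define \<Z> where "\<Z> z = {S \<in> \<T>\<^sub>0. S \<subseteq> ?X \<and> z \<in> S \<and> e S \<notin> M Y}" for z
    let ?g = "\<lambda>z. \<Sum>S\<in>\<Z> z. a S ?X *\<^sub>R e S"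
    obtain \<alpha> where \<alpha>: "\<alpha> > 0" "\<alpha> *\<^sub>R d T - (f v - ?g v) \<in> M Y"
      unfolding \<Z>_def Y_def by (rule flip_half[OF fp no])
    obtain \<alpha>' where \<alpha>': "\<alpha>' > 0" "\<alpha>' *\<^sub>R d T' - (f w - ?g w) \<in> M Y"
      unfolding \<Z>_def
      by (rule flip_half[OF flip_pair_sym[OF fp] no', unfolded Un_commute[of T' T] Y''])
    \<comment> \<open>The surviving tubes through \<open>v\<close> and those through
      \<open>w\<close> form disjoint families, so \<open>d ?X\<close> is the sum of the two
      halves.\<close>
    have "d ?X - (\<Sum>x\<in>{v, w}. f x) + (\<Sum>S\<in>\<Z> v \<union> \<Z> w. a S ?X *\<^sub>R e S) \<in> M Y"
    proof (rule d_reduce[OF fp'(3)])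
      fix S assume "S \<in> \<T>\<^sub>0" "S \<subseteq> ?X" "S \<notin> \<Z> v \<union> \<Z> w"
      then show "e S \<in> M Y" using e_in_M[of S Y] unfolding \<Z>_def Y_def by blast
    qed (use fp' in \<open>auto simp: \<Z>_def Y_def\<close>)
    moreover have "v \<noteq> w" using fp' by blast
    moreover have "(\<Sum>S\<in>\<Z> v \<union> \<Z> w. a S ?X *\<^sub>R e S) = ?g v + ?g w"
      by (rule sum.union_disjoint) (use finite0 no in \<open>auto simp: \<Z>_def\<close>)
    ultimately have X: "d ?X - (f v + f w) + (?g v + ?g w) \<in> M Y" by simp
    have "\<alpha> *\<^sub>R d T + \<alpha>' *\<^sub>R d T' - 1 *\<^sub>R d ?X
        = (\<alpha> *\<^sub>R d T - (f v - ?g v)) + (\<alpha>' *\<^sub>R d T' - (f w - ?g w)) - (d ?X - (f v + f w) + (?g v + ?g w))"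
      by simp
    also have "\<dots> \<in> M Y" by (rule M_diff[OF M_add[OF \<alpha>(2) \<alpha>'(2)] X])
    finally show ?thesis using that[of \<alpha> \<alpha>' 1] \<alpha>(1) \<alpha>'(1) by (simp add: Y_def)
  qed
qed

end

theorem theorem6p3:
  fixes G :: "('a, 'b) pre_digraph" and \<T>\<^sub>0 :: "'a set set"
  assumes "Digraph.graph G"
    and "maximal_tubing G \<T>\<^sub>0"
  shows "(\<forall>U. proper_tube G U \<longrightarrow>
            (\<forall>\<T> \<T>'. maximal_tubing G \<T> \<and> U \<in> \<T> \<and> maximal_tubing G \<T>' \<and> U \<in> \<T>' \<longrightarrow>
               span {compat_vector G \<T>\<^sub>0 S | S. S \<in> \<T> \<and> S \<subseteq> U} =
               span {compat_vector G \<T>\<^sub>0 S | S. S \<in> \<T>' \<and> S \<subseteq> U}))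
       \<and> (\<forall>\<T> \<T>' T T'.
            maximal_tubing G \<T> \<and> maximal_tubing G \<T>' \<and> T \<in> \<T> \<and> T' \<in> \<T>' \<and>
            T \<noteq> T' \<and> \<T> - {T} = \<T>' - {T'} \<longrightarrow>
            (\<exists>(\<alpha>::real) (\<alpha>'::real) (\<beta> :: 'a set \<Rightarrow> real).
               \<alpha> *\<^sub>R compat_vector G \<T>\<^sub>0 T + \<alpha>' *\<^sub>R compat_vector G \<T>\<^sub>0 T'
                 + (\<Sum>S\<in>\<T> \<inter> \<T>'. \<beta> S *\<^sub>R compat_vector G \<T>\<^sub>0 S) = 0 \<and>
               \<alpha> \<noteq> 0 \<and> \<alpha>' \<noteq> 0 \<and> sgn \<alpha> = sgn \<alpha>' \<and>
               (\<forall>S\<in>\<T> \<inter> \<T>'. \<not> S \<subseteq> T \<union> T' \<longrightarrow> \<beta> S = 0)))"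
proof -
  interpret graph_with_tubing G \<T>\<^sub>0
    using assms by (simp add: graph_with_tubing_def graph_with_tubing_axioms_def)
  have span_eq: "span {d S | S. S \<in> \<T> \<and> S \<subseteq> U} = M U"
    if "maximal_tubing G \<T>" "U \<in> \<T>" for \<T> U
  proof -
    have "{d S | S. S \<in> \<T> \<and> S \<subseteq> U} = d ` {S \<in> \<T>. S \<subseteq> U}" by blast
    then show ?thesis using span_compat_vectors[OF that(1), of "{U}" U] that(2) by simp
  qed
  have flip: "\<exists>\<alpha> \<alpha>' \<beta>. \<alpha> *\<^sub>R d T + \<alpha>' *\<^sub>R d T' + (\<Sum>S\<in>\<T> \<inter> \<T>'. \<beta> S *\<^sub>R d S) = 0 \<and>
      \<alpha> \<noteq> 0 \<and> \<alpha>' \<noteq> 0 \<and> sgn \<alpha> = sgn \<alpha>' \<and> (\<forall>S\<in>\<T> \<inter> \<T>'. \<not> S \<subseteq> T \<union> T' \<longrightarrow> \<beta> S = 0)"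
    if max: "maximal_tubing G \<T>" "maximal_tubing G \<T>'" and TT: "T \<in> \<T>" "T' \<in> \<T>'"
      and ne: "T \<noteq> T'" and eq: "\<T> - {T} = \<T>' - {T'}" for \<T> \<T>' T T'
  proof -
    let ?X = "T \<union> T'"
    obtain v w where fp: "flip_pair v w T T'"
      and cover: "?X - {v, w} = \<Union>{S \<in> \<T> \<inter> \<T>'. S \<subseteq> ?X - {v, w}}"
      by (rule flip_pair_exists[OF max TT ne eq])
    define Y where "Y = ?X - {v, w}"
    note fp' = flip_pairD[OF fp]
    obtain \<alpha> \<alpha>' \<gamma> where pos: "\<alpha> > 0" "\<alpha>' > 0" and rel: "\<alpha> *\<^sub>R d T + \<alpha>' *\<^sub>R d T' - \<gamma> *\<^sub>R d ?X \<in> M Y"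
      unfolding Y_def by (rule flip_relation[OF fp])
    have fin: "finite (\<T> \<inter> \<T>')" using max tubing_finite by (auto simp: maximal_tubing_def)
    have sub: "{S \<in> \<T>. S \<subseteq> Y} \<subseteq> \<T> \<inter> \<T>'"
    proof
      fix S assume S: "S \<in> {S \<in> \<T>. S \<subseteq> Y}"
      then have "S \<noteq> T" using fp'(4) by (auto simp: Y_def)
      then show "S \<in> \<T> \<inter> \<T>'" using S eq by blast
    qed
    have "M Y = span (d ` {S \<in> \<T>. S \<subseteq> Y})"
      by (rule span_compat_vectors[OF max(1), symmetric, where \<S> = "{S \<in> \<T> \<inter> \<T>'. S \<subseteq> Y}"])
        (use cover in \<open>auto simp: Y_def\<close>)
    then have "\<alpha> *\<^sub>R d T + \<alpha>' *\<^sub>R d T' - \<gamma> *\<^sub>R d ?X \<in> span (d ` {S \<in> \<T>. S \<subseteq> Y})"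
      using rel by simp
    then obtain c where c: "\<alpha> *\<^sub>R d T + \<alpha>' *\<^sub>R d T' - \<gamma> *\<^sub>R d ?X = (\<Sum>S\<in>{S \<in> \<T>. S \<subseteq> Y}. c S *\<^sub>R d S)"
      by (rule span_image_finite[OF finite_subset[OF sub fin]])
    \<comment> \<open>The two nonzero branches exclude each other since \<open>?X\<close> contains
      \<open>v\<close> and \<open>Y\<close> does not.\<close>
    define \<beta> where "\<beta> S = (if S \<subseteq> Y then - c S else if S = ?X then - \<gamma> else 0)" for S
    have XY: "\<not> ?X \<subseteq> Y" using fp'(4) by (auto simp: Y_def)
    \<comment> \<open>If \<open>?X\<close> is not a summation index, its term must vanish for the
      sum to be correct.\<close>
    have X0: "d ?X = 0" if "?X \<notin> \<T> \<inter> \<T>'"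
      using d_eq_0[OF fp'(3)] flip_union_in[OF max TT ne eq] that by blast
    have "(\<Sum>S\<in>\<T> \<inter> \<T>'. \<beta> S *\<^sub>R d S)
        = (\<Sum>S\<in>\<T> \<inter> \<T>'. (if S \<subseteq> Y then - c S *\<^sub>R d S else 0) + (if S = ?X then - \<gamma> *\<^sub>R d ?X else 0))"
      by (intro sum.cong) (use XY in \<open>auto simp: \<beta>_def\<close>)
    also have "\<dots> = (\<Sum>S\<in>\<T> \<inter> \<T>'. if S \<subseteq> Y then - c S *\<^sub>R d S else 0) - \<gamma> *\<^sub>R d ?X"
      using fin X0 by (simp add: sum.distrib sum.delta)
    also have "(\<Sum>S\<in>\<T> \<inter> \<T>'. if S \<subseteq> Y then - c S *\<^sub>R d S else 0) = (\<Sum>S\<in>{S \<in> \<T>. S \<subseteq> Y}. - c S *\<^sub>R d S)"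
      using fin sub by (intro sum.mono_neutral_cong_right) auto
    also have "\<dots> = - (\<alpha> *\<^sub>R d T + \<alpha>' *\<^sub>R d T' - \<gamma> *\<^sub>R d ?X)"
      unfolding c by (simp add: sum_negf)
    finally have "\<alpha> *\<^sub>R d T + \<alpha>' *\<^sub>R d T' + (\<Sum>S\<in>\<T> \<inter> \<T>'. \<beta> S *\<^sub>R d S) = 0"
      by (simp only: fun_eq_iff) simp
    moreover have "\<forall>S\<in>\<T> \<inter> \<T>'. \<not> S \<subseteq> ?X \<longrightarrow> \<beta> S = 0" by (auto simp: \<beta>_def Y_def)
    ultimately show ?thesis
      by (rule_tac x = \<alpha> in exI, rule_tac x = \<alpha>' in exI, rule_tac x = \<beta> in exI) (use pos in simp)
  qed
  show ?thesis
  proof (intro conjI allI impI; (elim conjE)?)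
    fix U \<T> \<T>' assume "maximal_tubing G \<T>" "U \<in> \<T>" "maximal_tubing G \<T>'" "U \<in> \<T>'"
    then show "span {d S | S. S \<in> \<T> \<and> S \<subseteq> U} = span {d S | S. S \<in> \<T>' \<and> S \<subseteq> U}"
      by (simp add: span_eq)
  qed (rule flip)
qed

end
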